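(* Let $E\to (M,I)$ be a real vector bundle of rank $2n$ over a complex manifold, equipped with a connection $\nabla$ with curvature of type $(1,1)$, and let $J,K$ be sections of $\mathcal{C}(E)$ with $\nabla J=0$ and $K\nabla_vK=\nabla_{Iv}K$ for all $v\in TM$. Let $\nabla'=\nabla+\frac12(\nabla K)K$. Equip $E^{1,0}_J$ and $E^{0,1}_J$ with the $\overline{\partial}$-operator $\nabla^{0,1}$, and $E^{1,0}_K$ and $E^{0,1}_K$ with the $\overline{\partial}$-operator $\nabla'^{0,1}$. Then the following bundle maps over $(M,I)$ are holomorphic: 1) $J+K: E^{0,1}_{K}\to E^{0,1}_{J}$; 2) $J-K: E^{0,1}_{K}\to E^{1,0}_{J}$; 3) $J+K: E^{1,0}_{J}\to E^{1,0}_{K}$; 4) $J-K: E^{0,1}_{J}\to E^{1,0}_{K}$; 5) $[J,K]: E^{0,1}_{K}\to E^{1,0}_{K}$.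
   Context: $\mathcal{C}(E)=\{j\in \operatorname{End}E\mid j^2=-1\}$. $E_{\mathbb{C}}=E\otimes_{\mathbb{R}}\mathbb{C}$, and for a section $L$ of $\mathcal{C}(E)$, $E^{1,0}_L$ and $E^{0,1}_L$ are the $+i$ and $-i$ eigenbundles of $L$ in $E_{\mathbb{C}}$. The connection $\nabla$ has $(1,1)$ curvature if $R^\nabla(Iu,Iv)=R^\nabla(u,v)$; equivalently the $(0,1)$ part $\nabla^{0,1}$ (with respect to $I$) of the complex-linear extension of $\nabla$ to $E_{\mathbb{C}}$ satisfies $(\nabla^{0,1})^2=0$, i.e. is a $\overline\partial$-operator. Under the hypotheses, $\nabla'$ also has $(1,1)$ curvature and $\nabla'K=0$, so that $\nabla'^{0,1}$ is a $\overline\partial$-operator preserving $E^{1,0}_K$ and $E^{0,1}_K$ (on $E^{0,1}_K$ it coincides with $\nabla^{0,1}$), while $\nabla^{0,1}$ preserves $E^{1,0}_J$ and $E^{0,1}_J$. All endomorphisms are extended complex-linearly to $E_{\mathbb{C}}$. *)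

theory Defs
  imports "HOL-Analysis.Analysis"
begin

section \<open>Smooth maps and complex manifolds\<close>

text \<open>The sets \<open>S\<close> below are always open subsets of Euclidean spaces.\<close>

primrec Ck_on :: "nat \<Rightarrow> 'a::real_normed_vector set \<Rightarrow> ('a \<Rightarrow> 'b::real_normed_vector) \<Rightarrow> bool" where
  "Ck_on 0 S f \<longleftrightarrow> continuous_on S f"
| "Ck_on (Suc k) S f \<longleftrightarrow> (\<forall>x\<in>S. f differentiable (at x)) \<and>
     (\<forall>v. Ck_on k S (\<lambda>x. frechet_derivative f (at x) v))"

definition smooth_on :: "'a::real_normed_vector set \<Rightarrow> ('a \<Rightarrow> 'b::real_normed_vector) \<Rightarrow> bool" where
  "smooth_on S f \<longleftrightarrow> (\<forall>k. Ck_on k S f)"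

definition holomorphic_vec_on :: "(complex^'d) set \<Rightarrow> (complex^'d \<Rightarrow> complex^'d) \<Rightarrow> bool" where
  "holomorphic_vec_on S f \<longleftrightarrow>
     (\<forall>z\<in>S. \<exists>f'. (f has_derivative f') (at z) \<and> (\<forall>a x. f' (a *s x) = a *s f' x))"

text \<open>A chart is its domain together with a map that is only relevant on that domain.\<close>

type_synonym ('m, 'd) chart = "'m set \<times> ('m \<Rightarrow> complex^'d)"

abbreviation chart_inv :: "('m, 'd) chart \<Rightarrow> complex^'d \<Rightarrow> 'm" where
  "chart_inv c \<equiv> inv_into (fst c) (snd c)"

text \<open>The manifold is the whole (Hausdorff, second countable) type \<open>'m\<close>; the atlas need not
  be maximal.\<close>

definition complex_manifold ::
  "('m::{t2_space,second_countable_topology}, 'd::finite) chart set \<Rightarrow> bool" where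
  "complex_manifold A \<longleftrightarrow>
     (\<Union>c\<in>A. fst c) = UNIV \<and>
     (\<forall>c\<in>A. open (fst c) \<and> open (snd c ` fst c) \<and>
            homeomorphism (fst c) (snd c ` fst c) (snd c) (chart_inv c)) \<and>
     (\<forall>c\<in>A. \<forall>c'\<in>A. holomorphic_vec_on (snd c ` (fst c \<inter> fst c')) (snd c' \<circ> chart_inv c))"

definition smooth_map ::
  "('m, 'd::finite) chart set \<Rightarrow> 'm set \<Rightarrow> ('m \<Rightarrow> 'b::real_normed_vector) \<Rightarrow> bool" where
  "smooth_map A U f \<longleftrightarrow> (\<forall>c\<in>A. smooth_on (snd c ` (U \<inter> fst c)) (f \<circ> chart_inv c))"


section \<open>Tangent vectors\<close>

text \<open>The real tangent space at \<open>p\<close> is modelled as \<open>complex^'d\<close>, regarded as a real vector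
  space: a tangent vector is given by its components in one chart \<open>chart_at A p\<close> around \<open>p\<close>,
  fixed once and for all. Its components in any other chart \<open>c\<close> around \<open>p\<close> are obtained by
  differentiating the coordinate map, that is, they are \<open>tderiv A p v (snd c)\<close>. The choice made
  at different points is unrelated, so smoothness of a vector field is expressed through these
  components. As the transition maps are holomorphic, the complex structure \<open>I\<close> of the manifold
  is multiplication by the imaginary unit in every chart.\<close>

definition chart_at :: "('m, 'd) chart set \<Rightarrow> 'm \<Rightarrow> ('m, 'd) chart" where
  "chart_at A p = (SOME c. c \<in> A \<and> p \<in> fst c)"

definition tderiv ::
  "('m, 'd::finite) chart set \<Rightarrow> 'm \<Rightarrow> complex^'d \<Rightarrow> ('m \<Rightarrow> 'b::real_normed_vector) \<Rightarrow> 'b" where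
  "tderiv A p v f =
     frechet_derivative (f \<circ> chart_inv (chart_at A p)) (at (snd (chart_at A p) p)) v"

definition cxI :: "complex^'d \<Rightarrow> complex^'d" where
  "cxI v = \<i> *s v"

definition smooth_vector_field ::
  "('m, 'd::finite) chart set \<Rightarrow> 'm set \<Rightarrow> ('m \<Rightarrow> complex^'d) \<Rightarrow> bool" where
  "smooth_vector_field A U X \<longleftrightarrow>
     (\<forall>c\<in>A. smooth_map A (U \<inter> fst c) (\<lambda>q. tderiv A q (X q) (snd c)))"

text \<open>The coordinate formula \<open>[X,Y] = X(Y) - Y(X)\<close>, computed in the chart \<open>chart_at A p\<close>.\<close>

definition lie_bracket ::
  "('m, 'd::finite) chart set \<Rightarrow> ('m \<Rightarrow> complex^'d) \<Rightarrow> ('m \<Rightarrow> complex^'d) \<Rightarrow> 'm \<Rightarrow> complex^'d" where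
  "lie_bracket A X Y p =
     tderiv A p (X p) (\<lambda>q. tderiv A q (Y q) (snd (chart_at A p))) -
     tderiv A p (Y p) (\<lambda>q. tderiv A q (X q) (snd (chart_at A p)))"


section \<open>Real vector bundles and connections\<close>

text \<open>The fibres are linear subspaces of an ambient real vector space \<open>'e\<close> that carries no further
  structure; the smooth structure comes from the local trivialisations \<open>(U, \<psi>)\<close>, where \<open>\<psi> p\<close>
  is a linear isomorphism from \<open>real^'r\<close> onto the fibre at \<open>p \<in> U\<close>. The rank is \<open>CARD('r)\<close>.\<close>

record ('m, 'e, 'r::finite) vbundle =
  fiber :: "'m \<Rightarrow> 'e set"
  trivs :: "('m set \<times> ('m \<Rightarrow> real^'r \<Rightarrow> 'e)) set"

definition vector_bundle ::
  "('m::topological_space, 'd::finite) chart set \<Rightarrow> ('m, 'e::real_vector, 'r::finite) vbundle \<Rightarrow> bool" where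
  "vector_bundle A E \<longleftrightarrow>
     (\<Union>(U, \<psi>)\<in>trivs E. U) = UNIV \<and>
     (\<forall>(U, \<psi>)\<in>trivs E. open U \<and>
        (\<forall>p\<in>U. linear (\<psi> p) \<and> inj (\<psi> p) \<and> range (\<psi> p) = fiber E p)) \<and>
     (\<forall>(U, \<psi>)\<in>trivs E. \<forall>(U', \<psi>')\<in>trivs E. \<forall>w.
        smooth_map A (U \<inter> U') (\<lambda>p. inv (\<psi>' p) (\<psi> p w)))"

definition smooth_section ::
  "('m, 'd::finite) chart set \<Rightarrow> ('m, 'e::real_vector, 'r::finite) vbundle \<Rightarrow> 'm set \<Rightarrow> ('m \<Rightarrow> 'e) \<Rightarrow> bool" where
  "smooth_section A E U s \<longleftrightarrow>
     (\<forall>p\<in>U. s p \<in> fiber E p) \<and>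
     (\<forall>(V, \<psi>)\<in>trivs E. smooth_map A (U \<inter> V) (\<lambda>p. inv (\<psi> p) (s p)))"

definition End_section ::
  "('m, 'd::finite) chart set \<Rightarrow> ('m, 'e::real_vector, 'r::finite) vbundle \<Rightarrow> ('m \<Rightarrow> 'e \<Rightarrow> 'e) \<Rightarrow> bool" where
  "End_section A E L \<longleftrightarrow>
     (\<forall>p. \<forall>e\<in>fiber E p. L p e \<in> fiber E p \<and>
        (\<forall>e'\<in>fiber E p. L p (e + e') = L p e + L p e') \<and> (\<forall>a. L p (a *\<^sub>R e) = a *\<^sub>R L p e)) \<and>
     (\<forall>(U, \<psi>)\<in>trivs E. \<forall>w. smooth_map A U (\<lambda>p. inv (\<psi> p) (L p (\<psi> p w))))"

text \<open>Sections of \<open>C(E)\<close>.\<close>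

definition C_section ::
  "('m, 'd::finite) chart set \<Rightarrow> ('m, 'e::real_vector, 'r::finite) vbundle \<Rightarrow> ('m \<Rightarrow> 'e \<Rightarrow> 'e) \<Rightarrow> bool" where
  "C_section A E L \<longleftrightarrow> End_section A E L \<and> (\<forall>p. \<forall>e\<in>fiber E p. L p (L p e) = - e)"

text \<open>\<open>D p v s\<close> is the derivative at \<open>p\<close>, in the direction \<open>v\<close>, of a smooth section \<open>s\<close> defined
  on some neighbourhood of \<open>p\<close>; it is irrelevant what \<open>s\<close> is outside of that neighbourhood.\<close>

type_synonym ('m, 'd, 'e) covariant_deriv = "'m \<Rightarrow> complex^'d \<Rightarrow> ('m \<Rightarrow> 'e) \<Rightarrow> 'e"

definition connection ::
  "('m::topological_space, 'd::finite) chart set \<Rightarrow> ('m, 'e::real_vector, 'r::finite) vbundle \<Rightarrow>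
   ('m, 'd, 'e) covariant_deriv \<Rightarrow> bool" where
  "connection A E D \<longleftrightarrow> (\<forall>U s. open U \<longrightarrow> smooth_section A E U s \<longrightarrow>
     (\<forall>p\<in>U. linear (\<lambda>v. D p v s) \<and>
       (\<forall>v. D p v s \<in> fiber E p \<and>
         (\<forall>t. smooth_section A E U t \<longrightarrow> D p v (\<lambda>q. s q + t q) = D p v s + D p v t) \<and>
         (\<forall>f. smooth_map A U f \<longrightarrow>
            D p v (\<lambda>q. f q *\<^sub>R s q) = tderiv A p v f *\<^sub>R s p + f p *\<^sub>R D p v s) \<and>
         (\<forall>t. (\<forall>q\<in>U. t q = s q) \<longrightarrow> D p v t = D p v s))) \<and>
     (\<forall>X. smooth_vector_field A U X \<longrightarrow> smooth_section A E U (\<lambda>p. D p (X p) s)))"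

definition curvature ::
  "('m, 'd::finite) chart set \<Rightarrow> ('m, 'd, 'e::real_vector) covariant_deriv \<Rightarrow>
   ('m \<Rightarrow> complex^'d) \<Rightarrow> ('m \<Rightarrow> complex^'d) \<Rightarrow> ('m \<Rightarrow> 'e) \<Rightarrow> 'm \<Rightarrow> 'e" where
  "curvature A D X Y s p =
     D p (X p) (\<lambda>q. D q (Y q) s) - D p (Y p) (\<lambda>q. D q (X q) s) - D p (lie_bracket A X Y p) s"

definition curvature_type_11 ::
  "('m::topological_space, 'd::finite) chart set \<Rightarrow> ('m, 'e::real_vector, 'r::finite) vbundle \<Rightarrow>
   ('m, 'd, 'e) covariant_deriv \<Rightarrow> bool" where
  "curvature_type_11 A E D \<longleftrightarrow>
     (\<forall>U X Y s. open U \<longrightarrow> smooth_vector_field A U X \<longrightarrow> smooth_vector_field A U Y \<longrightarrow>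
        smooth_section A E U s \<longrightarrow>
        (\<forall>p\<in>U. curvature A D (\<lambda>q. cxI (X q)) (\<lambda>q. cxI (Y q)) s p = curvature A D X Y s p))"

text \<open>The induced connection on \<open>End E\<close>: \<open>(\<nabla>\<^sub>v L) s = \<nabla>\<^sub>v (L s) - L (\<nabla>\<^sub>v s)\<close>. For smooth \<open>s\<close> the value
  at \<open>p\<close> depends on \<open>s p\<close> only.\<close>

definition nabla_End ::
  "('m, 'd, 'e::real_vector) covariant_deriv \<Rightarrow> ('m \<Rightarrow> 'e \<Rightarrow> 'e) \<Rightarrow> ('m, 'd, 'e) covariant_deriv" where
  "nabla_End D L p v s = D p v (\<lambda>q. L q (s q)) - L p (D p v s)"

text \<open>\<open>\<nabla>' = \<nabla> + 1/2 (\<nabla>K) K\<close>\<close>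

definition twisted_connection ::
  "('m, 'd, 'e::real_vector) covariant_deriv \<Rightarrow> ('m \<Rightarrow> 'e \<Rightarrow> 'e) \<Rightarrow> ('m, 'd, 'e) covariant_deriv" where
  "twisted_connection D K p v s = D p v s + (1/2) *\<^sub>R nabla_End D K p v (\<lambda>q. K q (s q))"


section \<open>Complexification\<close>

text \<open>The complexification of a real vector space consists of pairs \<open>(a, b)\<close>, read as \<open>a + \<i> b\<close>.
  It is applied to the fibres of \<open>E\<close> and to the tangent spaces; in the latter case \<open>cscale \<i>\<close> must
  not be confused with \<open>cext cxI\<close>, the complex-linear extension of \<open>I\<close>.\<close>

definition cscale :: "complex \<Rightarrow> 'a \<times> 'a \<Rightarrow> 'a \<times> 'a::real_vector" where
  "cscale z x = (Re z *\<^sub>R fst x - Im z *\<^sub>R snd x, Re z *\<^sub>R snd x + Im z *\<^sub>R fst x)"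

definition cext :: "('a \<Rightarrow> 'b) \<Rightarrow> 'a \<times> 'a \<Rightarrow> 'b \<times> 'b" where
  "cext f x = (f (fst x), f (snd x))"

type_synonym 'd ctangent = "(complex^'d) \<times> (complex^'d)"

definition T10 :: "'d::finite ctangent set" where
  "T10 = {X. cext cxI X = cscale \<i> X}"

definition T01 :: "'d::finite ctangent set" where
  "T01 = {X. cext cxI X = cscale (- \<i>) X}"

definition proj01 :: "'d::finite ctangent \<Rightarrow> 'd ctangent" where
  "proj01 X = (1/2) *\<^sub>R (X + cscale \<i> (cext cxI X))"

definition smooth_vector_fieldC ::
  "('m, 'd::finite) chart set \<Rightarrow> 'm set \<Rightarrow> ('m \<Rightarrow> 'd ctangent) \<Rightarrow> bool" where
  "smooth_vector_fieldC A U X \<longleftrightarrow>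
     smooth_vector_field A U (\<lambda>p. fst (X p)) \<and> smooth_vector_field A U (\<lambda>p. snd (X p))"

definition lie_bracketC ::
  "('m, 'd::finite) chart set \<Rightarrow> ('m \<Rightarrow> 'd ctangent) \<Rightarrow> ('m \<Rightarrow> 'd ctangent) \<Rightarrow> 'm \<Rightarrow> 'd ctangent" where
  "lie_bracketC A X Y p =
     (let X1 = \<lambda>q. fst (X q); X2 = \<lambda>q. snd (X q); Y1 = \<lambda>q. fst (Y q); Y2 = \<lambda>q. snd (Y q)
      in (lie_bracket A X1 Y1 p - lie_bracket A X2 Y2 p,
          lie_bracket A X1 Y2 p + lie_bracket A X2 Y1 p))"

definition tderivC :: "('m, 'd::finite) chart set \<Rightarrow> 'm \<Rightarrow> 'd ctangent \<Rightarrow> ('m \<Rightarrow> complex) \<Rightarrow> complex" where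
  "tderivC A p X f = tderiv A p (fst X) f + \<i> * tderiv A p (snd X) f"

definition fiberC :: "('m, 'e, 'r::finite) vbundle \<Rightarrow> 'm \<Rightarrow> ('e \<times> 'e) set" where
  "fiberC E p = fiber E p \<times> fiber E p"

definition E10 ::
  "('m, 'e::real_vector, 'r::finite) vbundle \<Rightarrow> ('m \<Rightarrow> 'e \<Rightarrow> 'e) \<Rightarrow> 'm \<Rightarrow> ('e \<times> 'e) set" where
  "E10 E L p = {x \<in> fiberC E p. cext (L p) x = cscale \<i> x}"

definition E01 ::
  "('m, 'e::real_vector, 'r::finite) vbundle \<Rightarrow> ('m \<Rightarrow> 'e \<Rightarrow> 'e) \<Rightarrow> 'm \<Rightarrow> ('e \<times> 'e) set" where
  "E01 E L p = {x \<in> fiberC E p. cext (L p) x = cscale (- \<i>) x}"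

text \<open>Smooth sections over \<open>U\<close> of a family \<open>V\<close> of subspaces of \<open>E \<otimes> \<complex>\<close>.\<close>

definition smooth_sectionC ::
  "('m, 'd::finite) chart set \<Rightarrow> ('m, 'e::real_vector, 'r::finite) vbundle \<Rightarrow> ('m \<Rightarrow> ('e \<times> 'e) set) \<Rightarrow>
   'm set \<Rightarrow> ('m \<Rightarrow> 'e \<times> 'e) \<Rightarrow> bool" where
  "smooth_sectionC A E V U s \<longleftrightarrow>
     smooth_section A E U (\<lambda>p. fst (s p)) \<and> smooth_section A E U (\<lambda>p. snd (s p)) \<and>
     (\<forall>p\<in>U. s p \<in> V p)"

type_synonym ('m, 'd, 'e) covariant_derivC = "'m \<Rightarrow> 'd ctangent \<Rightarrow> ('m \<Rightarrow> 'e \<times> 'e) \<Rightarrow> 'e \<times> 'e"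

text \<open>The complex-linear extension of a connection, in the direction as well as in the section.\<close>

definition nablaC ::
  "('m, 'd::finite, 'e::real_vector) covariant_deriv \<Rightarrow> ('m, 'd, 'e) covariant_derivC" where
  "nablaC D p X s =
     (let s1 = \<lambda>q. fst (s q); s2 = \<lambda>q. snd (s q)
      in (D p (fst X) s1 - D p (snd X) s2, D p (fst X) s2 + D p (snd X) s1))"

definition nabla01 ::
  "('m, 'd::finite, 'e::real_vector) covariant_deriv \<Rightarrow> ('m, 'd, 'e) covariant_derivC" where
  "nabla01 D p X s = nablaC D p (proj01 X) s"


section \<open>Dbar-operators and holomorphic bundle maps\<close>

text \<open>\<open>B p X s\<close> is the value at \<open>X\<close> of the (0,1)-form \<open>B s\<close> with values in \<open>V\<close>. The last clause
  says that the square of \<open>B\<close>, a (0,2)-form with values in \<open>End V\<close>, vanishes.\<close>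

definition dbar_operator ::
  "('m::topological_space, 'd::finite) chart set \<Rightarrow> ('m, 'e::real_vector, 'r::finite) vbundle \<Rightarrow>
   ('m \<Rightarrow> ('e \<times> 'e) set) \<Rightarrow> ('m, 'd, 'e) covariant_derivC \<Rightarrow> bool" where
  "dbar_operator A E V B \<longleftrightarrow> (\<forall>U s. open U \<longrightarrow> smooth_sectionC A E V U s \<longrightarrow>
     (\<forall>p\<in>U.
       (\<forall>X Y. B p (X + Y) s = B p X s + B p Y s) \<and>
       (\<forall>z X. B p (cscale z X) s = cscale z (B p X s)) \<and>
       (\<forall>X\<in>T10. B p X s = 0) \<and>
       (\<forall>X. B p X s \<in> V p \<and>
         (\<forall>t. smooth_sectionC A E V U t \<longrightarrow> B p X (\<lambda>q. s q + t q) = B p X s + B p X t) \<and>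
         (\<forall>f. smooth_map A U f \<longrightarrow>
            B p X (\<lambda>q. cscale (f q) (s q)) =
              cscale (tderivC A p (proj01 X) f) (s p) + cscale (f p) (B p X s)) \<and>
         (\<forall>t. (\<forall>q\<in>U. t q = s q) \<longrightarrow> B p X t = B p X s))) \<and>
     (\<forall>X. smooth_vector_fieldC A U X \<longrightarrow> smooth_sectionC A E V U (\<lambda>p. B p (X p) s)) \<and>
     (\<forall>X Y. smooth_vector_fieldC A U X \<longrightarrow> smooth_vector_fieldC A U Y \<longrightarrow>
        (\<forall>p\<in>U. X p \<in> T01 \<and> Y p \<in> T01) \<longrightarrow>
        (\<forall>p\<in>U. B p (X p) (\<lambda>q. B q (Y q) s) - B p (Y p) (\<lambda>q. B q (X q) s)
                 - B p (lie_bracketC A X Y p) s = 0)))"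

text \<open>A smooth complex-linear bundle map \<open>\<Phi>\<close> from \<open>(V, B)\<close> to \<open>(W, B')\<close> is holomorphic if it is
  annihilated by the induced dbar-operator on \<open>Hom(V, W)\<close>, that is, \<open>B' (\<Phi> s) = \<Phi> (B s)\<close> for all
  local smooth sections \<open>s\<close> of \<open>V\<close>.\<close>

definition holomorphic_bundle_map ::
  "('m::topological_space, 'd::finite) chart set \<Rightarrow> ('m, 'e::real_vector, 'r::finite) vbundle \<Rightarrow>
   ('m \<Rightarrow> ('e \<times> 'e) set) \<Rightarrow> ('m, 'd, 'e) covariant_derivC \<Rightarrow>
   ('m \<Rightarrow> ('e \<times> 'e) set) \<Rightarrow> ('m, 'd, 'e) covariant_derivC \<Rightarrow>
   ('m \<Rightarrow> 'e \<times> 'e \<Rightarrow> 'e \<times> 'e) \<Rightarrow> bool" where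
  "holomorphic_bundle_map A E V B W B' \<Phi> \<longleftrightarrow>
     dbar_operator A E V B \<and> dbar_operator A E W B' \<and>
     (\<forall>p. \<forall>x\<in>V p. \<Phi> p x \<in> W p \<and>
        (\<forall>y\<in>V p. \<Phi> p (x + y) = \<Phi> p x + \<Phi> p y) \<and> (\<forall>z. \<Phi> p (cscale z x) = cscale z (\<Phi> p x))) \<and>
     (\<forall>U s. open U \<longrightarrow> smooth_sectionC A E V U s \<longrightarrow>
        smooth_sectionC A E W U (\<lambda>p. \<Phi> p (s p)) \<and>
        (\<forall>p\<in>U. \<forall>X. B' p X (\<lambda>q. \<Phi> q (s q)) = \<Phi> p (B p X s)))"

end

theory Submission
  imports Defs
begin

text \<open>Let \<open>T = \<nabla> - \<nabla>'\<close>. Since \<open>\<nabla>' = 1/2 (\<nabla> - K \<nabla> K)\<close>, the connection \<open>\<nabla>'\<close> is the part of \<open>\<nabla>\<close>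
  commuting with \<open>K\<close>, and \<open>T\<close> is the part anticommuting with \<open>K\<close>. The hypothesis on \<open>K\<close> says that
  \<open>T\<^sub>I\<^sub>v = K T\<^sub>v\<close> (lemma \<open>antilinear_part_cxI\<close>), and everything follows from this.

  Taking the part of the curvature \<open>R\<close> of \<open>\<nabla>\<close> that commutes with \<open>K\<close>, one finds for the curvature
  \<open>R'\<close> of \<open>\<nabla>'\<close> that \<open>R'(X,Y) = 1/2 (R(X,Y) - K R(X,Y) K) - [T\<^sub>X, T\<^sub>Y]\<close> (lemma \<open>curvature_twisted\<close>), where
  \<open>T\<^sub>I\<^sub>X T\<^sub>I\<^sub>Y = K T\<^sub>X K T\<^sub>Y = T\<^sub>X T\<^sub>Y\<close>. So \<open>\<nabla>'\<close> has curvature of type (1,1) as well. For a connection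
  of this type \<open>\<nabla>\<^sup>0\<^sup>,\<^sup>1\<close> is a dbar-operator on every stable family of subspaces (lemma
  \<open>dbar_operator_nabla01\<close>), and because of \<open>\<nabla>J = 0\<close> and \<open>\<nabla>'K = 0\<close> the four eigenbundles are stable.

  A section of \<open>E\<^sup>0\<^sup>,\<^sup>1\<^sub>L\<close> is \<open>a + \<i> L a\<close> for a real section \<open>a\<close>, and \<open>E\<^sup>1\<^sup>,\<^sup>0\<^sub>L\<close> is the bundle
  \<open>E\<^sup>0\<^sup>,\<^sup>1\<close> of \<open>-L\<close>. A real endomorphism \<open>P\<close> with \<open>P L = L' P\<close> is therefore holomorphic from
  \<open>(E\<^sup>0\<^sup>,\<^sup>1\<^sub>L, \<nabla>\<^sub>1)\<close> to \<open>(E\<^sup>0\<^sup>,\<^sup>1\<^sub>L\<^sub>', \<nabla>\<^sub>2)\<close> if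
  \<open>\<nabla>\<^sub>2\<^sub>,\<^sub>v (P a) - \<nabla>\<^sub>2\<^sub>,\<^sub>I\<^sub>v (P L a) = P (\<nabla>\<^sub>1\<^sub>,\<^sub>v a - \<nabla>\<^sub>1\<^sub>,\<^sub>I\<^sub>v (L a))\<close> (lemma
  \<open>holomorphic_bundle_mapI\<close>). For \<open>P = J \<plusminus> K\<close> this is a computation with \<open>\<nabla> = \<nabla>' + T\<close>, and the
  commutator \<open>[J,K] = (J - K) (J + K)\<close> is the composite of two of these maps.\<close>

section \<open>Calculus of smooth maps\<close>

lemma has_derivative_cong_open:
  assumes "open S" "x \<in> S" "\<And>y. y \<in> S \<Longrightarrow> f y = g y"
  shows "(f has_derivative f') (at x) \<longleftrightarrow> (g has_derivative f') (at x)"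
  using has_derivative_transform_within_open[OF _ assms(1,2), of f f' UNIV g]
    has_derivative_transform_within_open[OF _ assms(1,2), of g f' UNIV f] assms(3)
  by auto

lemma frechet_derivative_cong_open:
  assumes "open S" "x \<in> S" "\<And>y. y \<in> S \<Longrightarrow> f y = g y"
  shows "frechet_derivative f (at x) = frechet_derivative g (at x)"
  unfolding frechet_derivative_def using has_derivative_cong_open[OF assms] by simp

lemma differentiable_cong_open:
  assumes "open S" "x \<in> S" "\<And>y. y \<in> S \<Longrightarrow> f y = g y"
  shows "f differentiable (at x) \<longleftrightarrow> g differentiable (at x)"
  unfolding differentiable_def using has_derivative_cong_open[OF assms] by simp

text \<open>Smoothness on an open set only depends on the values there. This is used throughout because
  derivatives are computed by the usual rules only at points of \<open>S\<close>, while a condition on the next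
  derivative refers to a function on the whole space.\<close>

lemma Ck_on_cong:
  assumes "open S" "\<And>y. y \<in> S \<Longrightarrow> f y = g y" "Ck_on k S f"
  shows "Ck_on k S g"
  using assms(2,3)
proof (induction k arbitrary: f g)
  case 0
  then show ?case by (simp cong: continuous_on_cong)
next
  case (Suc k)
  have "Ck_on k S (\<lambda>x. frechet_derivative g (at x) v)" for v
    by (rule Suc.IH[of "\<lambda>x. frechet_derivative f (at x) v"])
      (use Suc.prems assms(1) in \<open>auto simp: frechet_derivative_cong_open[of S _ f g]\<close>)
  then show ?case
    using Suc.prems assms(1) by (auto simp: differentiable_cong_open[of S _ f g])
qed

text \<open>For the product rule below, where the factors also occur undifferentiated.\<close>

lemma Ck_on_SucD: "Ck_on (Suc k) S f \<Longrightarrow> Ck_on k S f"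
proof (induction k arbitrary: f)
  case 0
  then show ?case
    by (auto intro!: continuous_at_imp_continuous_on differentiable_imp_continuous_within)
next
  case (Suc k)
  then show ?case by (metis Ck_on.simps(2))
qed

lemma Ck_on_subset: "Ck_on k S f \<Longrightarrow> T \<subseteq> S \<Longrightarrow> Ck_on k T f"
  by (induction k arbitrary: f) (auto intro: continuous_on_subset)

lemma Ck_on_const: "Ck_on k S (\<lambda>_. a)"
  by (induction k arbitrary: a) auto

lemma Ck_on_add:
  assumes "open S" "Ck_on k S f" "Ck_on k S g"
  shows "Ck_on k S (\<lambda>x. f x + g x)"
  using assms(2,3)
proof (induction k arbitrary: f g)
  case 0
  then show ?case by (simp add: continuous_on_add)
next
  case (Suc k)
  have "Ck_on k S (\<lambda>x. frechet_derivative (\<lambda>x. f x + g x) (at x) v)" for v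
  proof (rule Ck_on_cong[OF assms(1)])
    show "Ck_on k S (\<lambda>x. frechet_derivative f (at x) v + frechet_derivative g (at x) v)"
      using Suc by simp
  next
    fix x assume "x \<in> S"
    then have "(f has_derivative frechet_derivative f (at x)) (at x)"
      "(g has_derivative frechet_derivative g (at x)) (at x)"
      using Suc.prems by (auto simp: frechet_derivative_works)
    from frechet_derivative_at[OF has_derivative_add[OF this]]
    show "frechet_derivative f (at x) v + frechet_derivative g (at x) v
      = frechet_derivative (\<lambda>x. f x + g x) (at x) v"
      by (rule fun_cong)
  qed
  then show ?case using Suc.prems by simp
qed

lemma frechet_derivative_linear_image:
  assumes "bounded_linear L" "f differentiable (at x)"
  shows "frechet_derivative (\<lambda>x. L (f x)) (at x) v = L (frechet_derivative f (at x) v)"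
  using frechet_derivative_at[OF bounded_linear.has_derivative[OF assms(1)
        assms(2)[unfolded frechet_derivative_works]]]
  by (rule fun_cong[symmetric])

lemma differentiable_linear_image:
  assumes "bounded_linear L" "f differentiable (at x)"
  shows "(\<lambda>x. L (f x)) differentiable (at x)"
  using assms bounded_linear.has_derivative unfolding differentiable_def by blast

lemma Ck_on_linear_image:
  assumes "open S" "bounded_linear L" "Ck_on k S f"
  shows "Ck_on k S (\<lambda>x. L (f x))"
  using assms(3)
proof (induction k arbitrary: f)
  case 0
  then show ?case
    using bounded_linear.continuous_on[OF assms(2)] by simp
next
  case (Suc k)
  have "Ck_on k S (\<lambda>x. frechet_derivative (\<lambda>x. L (f x)) (at x) v)" for v
  proof (rule Ck_on_cong[OF assms(1)])
    show "Ck_on k S (\<lambda>x. L (frechet_derivative f (at x) v))"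
      using Suc by simp
  qed (use Suc.prems assms(2) in \<open>simp add: frechet_derivative_linear_image\<close>)
  then show ?case using Suc.prems assms(2) by (simp add: differentiable_linear_image)
qed

lemma has_derivative_scaleR_frechet:
  fixes f :: "'a::real_normed_vector \<Rightarrow> real"
  assumes "f differentiable (at x)" "g differentiable (at x)"
  shows "((\<lambda>x. f x *\<^sub>R g x) has_derivative
     (\<lambda>v. f x *\<^sub>R frechet_derivative g (at x) v + frechet_derivative f (at x) v *\<^sub>R g x)) (at x)"
  using has_derivative_scaleR assms unfolding frechet_derivative_works by blast

lemma Ck_on_scaleR:
  fixes f :: "'a::real_normed_vector \<Rightarrow> real"
  assumes "open S" "Ck_on k S f" "Ck_on k S g"
  shows "Ck_on k S (\<lambda>x. f x *\<^sub>R g x)"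
  using assms(2,3)
proof (induction k arbitrary: f g)
  case 0
  then show ?case by (simp add: continuous_on_scaleR)
next
  case (Suc k)
  have "Ck_on k S (\<lambda>x. frechet_derivative (\<lambda>x. f x *\<^sub>R g x) (at x) v)" for v
  proof (rule Ck_on_cong[OF assms(1)])
    show "Ck_on k S (\<lambda>x. f x *\<^sub>R frechet_derivative g (at x) v + frechet_derivative f (at x) v *\<^sub>R g x)"
      using Suc.prems Ck_on_SucD[OF Suc.prems(1)] Ck_on_SucD[OF Suc.prems(2)]
      by (intro Ck_on_add[OF assms(1)] Suc.IH) auto
  next
    fix x assume "x \<in> S"
    then have "f differentiable (at x)" "g differentiable (at x)" using Suc.prems by auto
    from frechet_derivative_at[OF has_derivative_scaleR_frechet[OF this]]
    show "f x *\<^sub>R frechet_derivative g (at x) v + frechet_derivative f (at x) v *\<^sub>R g x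
      = frechet_derivative (\<lambda>x. f x *\<^sub>R g x) (at x) v"
      by (rule fun_cong)
  qed
  moreover have "(\<lambda>x. f x *\<^sub>R g x) differentiable (at x)" if "x \<in> S" for x
    using has_derivative_scaleR_frechet[of f x g] Suc.prems that
    by (meson Ck_on.simps(2) differentiableI)
  ultimately show ?case by simp
qed

section \<open>Smooth functions and vector fields on a complex manifold\<close>

lemma linear_cxI: "linear (cxI :: complex^'d::finite \<Rightarrow> complex^'d)"
  by (rule linearI) (simp_all add: cxI_def vec_eq_iff algebra_simps)

lemma bounded_linear_cxI: "bounded_linear (cxI :: complex^'d::finite \<Rightarrow> complex^'d)"
  using linear_cxI by (rule linear_conv_bounded_linear[THEN iffD1])

lemma cxI_cxI [simp]: "cxI (cxI v) = - (v :: complex^'d::finite)"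
  by (simp add: cxI_def vec_eq_iff)

locale complex_mfd =
  fixes A :: "('m::{t2_space,second_countable_topology}, 'd::finite) chart set"
  assumes complex_manifold: "complex_manifold A"
begin

lemma open_chart_domain: "c \<in> A \<Longrightarrow> open (fst c)"
  using complex_manifold by (simp add: complex_manifold_def)

lemma chart_inv_chart [simp]: "c \<in> A \<Longrightarrow> p \<in> fst c \<Longrightarrow> chart_inv c (snd c p) = p"
  using complex_manifold by (auto simp: complex_manifold_def homeomorphism_def)

lemma open_chart_image:
  assumes "open U" "c \<in> A"
  shows "open (snd c ` (U \<inter> fst c))"
proof -
  have h: "homeomorphism (fst c) (snd c ` fst c) (snd c) (chart_inv c)"
    and o: "open (snd c ` fst c)"
    using complex_manifold assms by (auto simp: complex_manifold_def)
  have "openin (top_of_set (snd c ` fst c)) (snd c ` (U \<inter> fst c))"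
    by (rule homeomorphism_imp_open_map[OF h])
      (use open_chart_domain[OF assms(2)] assms(1) in \<open>auto simp: openin_open\<close>)
  then show ?thesis using o openin_open_trans by blast
qed

lemma chart_at: "chart_at A p \<in> A" "p \<in> fst (chart_at A p)"
proof -
  have "\<exists>c. c \<in> A \<and> p \<in> fst c" using complex_manifold unfolding complex_manifold_def by blast
  from someI_ex[OF this] show "chart_at A p \<in> A" "p \<in> fst (chart_at A p)"
    by (auto simp: chart_at_def)
qed

lemma smooth_map_cong:
  assumes "open U" "\<And>q. q \<in> U \<Longrightarrow> f q = g q" "smooth_map A U f"
  shows "smooth_map A U g"
  unfolding smooth_map_def smooth_on_def
proof (intro ballI allI)
  fix c k assume c: "c \<in> A"
  show "Ck_on k (snd c ` (U \<inter> fst c)) (g \<circ> chart_inv c)"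
    by (rule Ck_on_cong[OF open_chart_image[OF assms(1) c], of "f \<circ> chart_inv c"])
      (use assms c in \<open>auto simp: smooth_map_def smooth_on_def\<close>)
qed

lemma smooth_map_subset: "smooth_map A U f \<Longrightarrow> V \<subseteq> U \<Longrightarrow> smooth_map A V f"
  unfolding smooth_map_def smooth_on_def by (meson Ck_on_subset Int_mono image_mono order_refl)

lemma smooth_map_const: "smooth_map A U (\<lambda>_. a)"
  by (simp add: smooth_map_def smooth_on_def Ck_on_const o_def)

lemma smooth_map_add:
  "open U \<Longrightarrow> smooth_map A U f \<Longrightarrow> smooth_map A U g \<Longrightarrow> smooth_map A U (\<lambda>q. f q + g q)"
  unfolding smooth_map_def smooth_on_def o_def by (intro ballI allI Ck_on_add open_chart_image) auto

lemma smooth_map_scaleR: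
  "open U \<Longrightarrow> smooth_map A U f \<Longrightarrow> smooth_map A U g \<Longrightarrow> smooth_map A U (\<lambda>q. f q *\<^sub>R g q)"
  unfolding smooth_map_def smooth_on_def o_def by (intro ballI allI Ck_on_scaleR open_chart_image) auto

lemma smooth_map_linear_image:
  "open U \<Longrightarrow> bounded_linear L \<Longrightarrow> smooth_map A U f \<Longrightarrow> smooth_map A U (\<lambda>q. L (f q))"
  unfolding smooth_map_def smooth_on_def o_def
  by (intro ballI allI Ck_on_linear_image[of _ L] open_chart_image) blast+

lemma smooth_map_sum:
  assumes "open U" "\<And>i. i \<in> I \<Longrightarrow> smooth_map A U (f i)"
  shows "smooth_map A U (\<lambda>q. \<Sum>i\<in>I. f i q)"
  using assms(2)
  by (induction I rule: infinite_finite_induct) (simp_all add: smooth_map_const smooth_map_add assms(1))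

lemma smooth_map_differentiable:
  assumes "smooth_map A U f" "p \<in> U" "c \<in> A" "p \<in> fst c"
  shows "(f \<circ> chart_inv c) differentiable (at (snd c p))"
proof -
  have "Ck_on (Suc 0) (snd c ` (U \<inter> fst c)) (f \<circ> chart_inv c)"
    using assms by (auto simp: smooth_map_def smooth_on_def simp del: Ck_on.simps)
  then show ?thesis using assms by auto
qed

lemma tderiv_cong:
  assumes "open U" "p \<in> U" "\<And>q. q \<in> U \<Longrightarrow> f q = g q"
  shows "tderiv A p v f = tderiv A p v g"
proof -
  let ?c = "chart_at A p"
  have "frechet_derivative (f \<circ> chart_inv ?c) (at (snd ?c p))
      = frechet_derivative (g \<circ> chart_inv ?c) (at (snd ?c p))"
    by (rule frechet_derivative_cong_open[OF open_chart_image[OF assms(1) chart_at(1)[of p]]])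
      (use assms chart_at in auto)
  then show ?thesis by (simp add: tderiv_def)
qed

lemma tderiv_const [simp]: "tderiv A p v (\<lambda>_. a) = 0"
  by (simp add: tderiv_def o_def)

lemma tderiv_linear_image:
  assumes "smooth_map A U f" "p \<in> U" "bounded_linear L"
  shows "tderiv A p v (\<lambda>q. L (f q)) = L (tderiv A p v f)"
  using frechet_derivative_linear_image[OF assms(3) smooth_map_differentiable[OF assms(1,2) chart_at]]
  by (simp add: tderiv_def o_def)

lemma linear_tderiv:
  assumes "smooth_map A U f" "p \<in> U"
  shows "linear (\<lambda>v. tderiv A p v f)"
  using linear_frechet_derivative[OF smooth_map_differentiable[OF assms chart_at]]
  by (simp add: tderiv_def)

text \<open>The coordinate components of a tangent vector depend complex-linearly on it because the
  transition maps are holomorphic; every compatibility of \<open>I\<close> with smoothness and with the Lie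
  bracket comes from this.\<close>

lemma chart_components:
  assumes "c \<in> A" "p \<in> fst c"
  shows linear_chart_components: "linear (\<lambda>v. tderiv A p v (snd c))"
    and chart_components_cxI: "tderiv A p (cxI v) (snd c) = cxI (tderiv A p v (snd c))"
proof -
  let ?c = "chart_at A p"
  have "holomorphic_vec_on (snd ?c ` (fst ?c \<inter> fst c)) (snd c \<circ> chart_inv ?c)"
    using complex_manifold chart_at assms by (simp add: complex_manifold_def)
  then obtain f' where f': "((snd c \<circ> chart_inv ?c) has_derivative f') (at (snd ?c p))"
    and lin: "\<And>a x. f' (a *s x) = a *s f' x"
    using chart_at assms unfolding holomorphic_vec_on_def by blast
  then have eq: "tderiv A p v (snd c) = f' v" for v
    by (metis frechet_derivative_at tderiv_def)
  show "linear (\<lambda>v. tderiv A p v (snd c))"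
    using f' has_derivative_linear by (simp add: eq)
  show "tderiv A p (cxI v) (snd c) = cxI (tderiv A p v (snd c))"
    by (simp add: eq cxI_def lin)
qed

lemma field_components_smooth:
  "smooth_vector_field A U X \<Longrightarrow> c \<in> A \<Longrightarrow> smooth_map A (U \<inter> fst c) (\<lambda>q. tderiv A q (X q) (snd c))"
  by (simp add: smooth_vector_field_def)

lemma smooth_vector_field_cxI:
  assumes "open U" "smooth_vector_field A U X"
  shows "smooth_vector_field A U (\<lambda>q. cxI (X q))"
  unfolding smooth_vector_field_def
proof
  fix c assume c: "c \<in> A"
  have o: "open (U \<inter> fst c)" using assms(1) open_chart_domain[OF c] by (rule open_Int)
  show "smooth_map A (U \<inter> fst c) (\<lambda>q. tderiv A q (cxI (X q)) (snd c))"
    by (rule smooth_map_cong[OF o _ smooth_map_linear_image[OF o bounded_linear_cxI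
            field_components_smooth[OF assms(2) c]]])
      (simp add: chart_components_cxI c)
qed

lemma smooth_vector_field_add:
  assumes "open U" "smooth_vector_field A U X" "smooth_vector_field A U Y"
  shows "smooth_vector_field A U (\<lambda>q. X q + Y q)"
  unfolding smooth_vector_field_def
proof
  fix c assume c: "c \<in> A"
  have o: "open (U \<inter> fst c)" using assms(1) open_chart_domain[OF c] by (rule open_Int)
  show "smooth_map A (U \<inter> fst c) (\<lambda>q. tderiv A q (X q + Y q) (snd c))"
    by (rule smooth_map_cong[OF o _ smooth_map_add[OF o field_components_smooth[OF assms(2) c]
            field_components_smooth[OF assms(3) c]]])
      (simp add: linear_add[OF linear_chart_components] c)
qed

lemma smooth_vector_field_scaleR:
  assumes "open U" "smooth_vector_field A U X"
  shows "smooth_vector_field A U (\<lambda>q. r *\<^sub>R X q)"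
  unfolding smooth_vector_field_def
proof
  fix c assume c: "c \<in> A"
  have o: "open (U \<inter> fst c)" using assms(1) open_chart_domain[OF c] by (rule open_Int)
  show "smooth_map A (U \<inter> fst c) (\<lambda>q. tderiv A q (r *\<^sub>R X q) (snd c))"
    by (rule smooth_map_cong[OF o _ smooth_map_linear_image[OF o bounded_linear_scaleR_right[of r]
            field_components_smooth[OF assms(2) c]]])
      (simp add: linear_cmul[OF linear_chart_components] c)
qed

lemma smooth_vector_field_minus:
  "open U \<Longrightarrow> smooth_vector_field A U X \<Longrightarrow> smooth_vector_field A U (\<lambda>q. - X q)"
  using smooth_vector_field_scaleR[of U X "-1"] by simp

lemma smooth_vector_field_diff:
  "open U \<Longrightarrow> smooth_vector_field A U X \<Longrightarrow> smooth_vector_field A U Y \<Longrightarrow>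
    smooth_vector_field A U (\<lambda>q. X q - Y q)"
  using smooth_vector_field_add[OF _ _ smooth_vector_field_minus, of U X Y] by simp

end

section \<open>The Lie bracket of vector fields of type (0,1)\<close>

lemma T01_iff: "X \<in> T01 \<longleftrightarrow> X = (fst X, cxI (fst X))"
proof -
  have "X \<in> T01 \<longleftrightarrow> cxI (fst X) = snd X \<and> cxI (snd X) = - fst X"
    by (simp add: T01_def cext_def cscale_def)
  also have "\<dots> \<longleftrightarrow> X = (fst X, cxI (fst X))"
    by (cases X) auto
  finally show ?thesis .
qed

lemma proj01_eq:
  "proj01 X = (let x = (1/2) *\<^sub>R (fst X - cxI (snd X)) in (x, cxI x))"
  by (simp add: proj01_def Let_def cext_def cscale_def prod_eq_iff linear_diff[OF linear_cxI]
      linear_cmul[OF linear_cxI] algebra_simps)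

lemma proj01_T01 [simp]: "X \<in> T01 \<Longrightarrow> proj01 X = X"
  by (subst (asm) T01_iff, cases X)
    (simp add: proj01_def cext_def cscale_def scaleR_2[symmetric])

lemma proj01_T10 [simp]: "X \<in> T10 \<Longrightarrow> proj01 X = 0"
  by (simp add: T10_def proj01_def cscale_def prod_eq_iff)

context complex_mfd
begin

text \<open>The function \<open>q \<mapsto> tderiv A q (Y q) (snd c)\<close> is the component function of \<open>Y\<close> in the chart \<open>c\<close>.
  Multiplication by \<open>\<i>\<close> and by real constants acts on these component functions themselves, so it
  passes through one further derivative.\<close>

lemma chart_bracket_term:
  assumes "open U" "smooth_vector_field A U Y" "p \<in> U"
  defines "c \<equiv> chart_at A p"
  shows "tderiv A p v (\<lambda>q. tderiv A q (cxI (Y q)) (snd c)) =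
      cxI (tderiv A p v (\<lambda>q. tderiv A q (Y q) (snd c)))"
    and "tderiv A p v (\<lambda>q. tderiv A q (r *\<^sub>R Y q) (snd c)) =
      r *\<^sub>R tderiv A p v (\<lambda>q. tderiv A q (Y q) (snd c))"
    and "linear (\<lambda>v. tderiv A p v (\<lambda>q. tderiv A q (Y q) (snd c)))"
proof -
  have c: "c \<in> A" "p \<in> fst c" by (simp_all add: c_def chart_at)
  have p: "p \<in> U \<inter> fst c" using assms(3) c by simp
  have o: "open (U \<inter> fst c)" using assms(1) open_chart_domain[OF c(1)] by (rule open_Int)
  note Y = field_components_smooth[OF assms(2) c(1)]
  have "tderiv A p v (\<lambda>q. tderiv A q (cxI (Y q)) (snd c)) =
      tderiv A p v (\<lambda>q. cxI (tderiv A q (Y q) (snd c)))"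
    by (rule tderiv_cong[OF o p]) (simp add: chart_components_cxI c)
  then show "tderiv A p v (\<lambda>q. tderiv A q (cxI (Y q)) (snd c)) =
      cxI (tderiv A p v (\<lambda>q. tderiv A q (Y q) (snd c)))"
    by (simp add: tderiv_linear_image[OF Y p bounded_linear_cxI])
  have "tderiv A p v (\<lambda>q. tderiv A q (r *\<^sub>R Y q) (snd c)) =
      tderiv A p v (\<lambda>q. r *\<^sub>R tderiv A q (Y q) (snd c))"
    by (rule tderiv_cong[OF o p]) (simp add: linear_cmul[OF linear_chart_components] c)
  then show "tderiv A p v (\<lambda>q. tderiv A q (r *\<^sub>R Y q) (snd c)) =
      r *\<^sub>R tderiv A p v (\<lambda>q. tderiv A q (Y q) (snd c))"
    by (simp add: tderiv_linear_image[OF Y p bounded_linear_scaleR_right])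
  show "linear (\<lambda>v. tderiv A p v (\<lambda>q. tderiv A q (Y q) (snd c)))"
    by (rule linear_tderiv[OF Y p])
qed

text \<open>A special case of bilinearity that suffices to move \<open>I\<close> from one argument of a curvature of type
  (1,1) to the other.\<close>

lemma lie_bracket_minus_right:
  assumes "open U" "smooth_vector_field A U Y" "smooth_vector_field A U X" "p \<in> U"
  shows "lie_bracket A X (\<lambda>q. - Y q) p = - lie_bracket A X Y p"
  using chart_bracket_term(2)[OF assms(1,2,4), of _ "-1"]
    linear_neg[OF chart_bracket_term(3)[OF assms(1,3,4)]]
  by (simp add: lie_bracket_def)

text \<open>The bracket of fields \<open>x + \<i> Ix\<close> and \<open>y + \<i> Iy\<close> is again of this form by the vanishing
  of the Nijenhuis tensor of \<open>I\<close>: in a chart \<open>I\<close> has constant coefficients.\<close>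

lemma lie_bracketC_T01:
  assumes U: "open U" "p \<in> U"
    and X: "smooth_vector_field A U x" and Y: "smooth_vector_field A U y"
  shows "lie_bracketC A (\<lambda>q. (x q, cxI (x q))) (\<lambda>q. (y q, cxI (y q))) p \<in> T01"
  unfolding T01_iff
  by (simp add: lie_bracketC_def lie_bracket_def
      chart_bracket_term(1)[OF U(1) X U(2)] chart_bracket_term(1)[OF U(1) Y U(2)]
      linear_diff[OF linear_cxI] linear_add[OF linear_cxI] linear_neg[OF linear_cxI] algebra_simps)

lemma lie_bracketC_cong:
  assumes "open U" "p \<in> U" "\<And>q. q \<in> U \<Longrightarrow> X q = X' q" "\<And>q. q \<in> U \<Longrightarrow> Y q = Y' q"
  shows "lie_bracketC A X Y p = lie_bracketC A X' Y' p"
proof -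
  have f: "tderiv A p v (\<lambda>q. tderiv A q (f (X q)) c) = tderiv A p v (\<lambda>q. tderiv A q (f (X' q)) c)"
    "tderiv A p v (\<lambda>q. tderiv A q (f (Y q)) c) = tderiv A p v (\<lambda>q. tderiv A q (f (Y' q)) c)" for v f c
    by (rule tderiv_cong[OF assms(1,2)]; simp add: assms)+
  show ?thesis
    using assms by (simp add: lie_bracketC_def lie_bracket_def Let_def f)
qed

end

section \<open>Sections of a vector bundle\<close>

locale smooth_bundle = complex_mfd A for A :: "('m::{t2_space,second_countable_topology}, 'd::finite) chart set" +
  fixes E :: "('m, 'e::real_vector, 'r::finite) vbundle"
  assumes vector_bundle: "vector_bundle A E"
begin

lemma triv:
  assumes "(V, \<psi>) \<in> trivs E"
  shows triv_open: "open V"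
    and triv_linear: "p \<in> V \<Longrightarrow> linear (\<psi> p)"
    and triv_inj: "p \<in> V \<Longrightarrow> inj (\<psi> p)"
    and triv_range: "p \<in> V \<Longrightarrow> range (\<psi> p) = fiber E p"
proof -
  have "\<forall>(U, \<psi>)\<in>trivs E. open U \<and>
      (\<forall>p\<in>U. linear (\<psi> p) \<and> inj (\<psi> p) \<and> range (\<psi> p) = fiber E p)"
    using vector_bundle unfolding vector_bundle_def by (elim conjE)
  from bspec[OF this assms]
  show "open V" "p \<in> V \<Longrightarrow> linear (\<psi> p)" "p \<in> V \<Longrightarrow> inj (\<psi> p)"
    "p \<in> V \<Longrightarrow> range (\<psi> p) = fiber E p"
    by auto
qed

lemma subspace_fiber: "subspace (fiber E p)"
proof -
  have "p \<in> (\<Union>(U, \<psi>)\<in>trivs E. U)"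
    using vector_bundle by (simp add: vector_bundle_def)
  then obtain V \<psi> where "(V, \<psi>) \<in> trivs E" "p \<in> V" by blast
  then show ?thesis
    using triv_range triv_linear linear_subspace_image[of "\<psi> p" UNIV] by fastforce
qed

lemmas fiber_add [simp] = subspace_add[OF subspace_fiber]
  and fiber_scaleR [simp] = subspace_scale[OF subspace_fiber]
  and fiber_diff [simp] = subspace_diff[OF subspace_fiber]
  and fiber_minus [simp] = subspace_neg[OF subspace_fiber]

lemma triv_inv:
  assumes "(V, \<psi>) \<in> trivs E" "p \<in> V"
  shows triv_inv_right: "e \<in> fiber E p \<Longrightarrow> \<psi> p (inv (\<psi> p) e) = e"
    and triv_inv_add: "e \<in> fiber E p \<Longrightarrow> e' \<in> fiber E p \<Longrightarrow>
      inv (\<psi> p) (e + e') = inv (\<psi> p) e + inv (\<psi> p) e'"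
    and triv_inv_scaleR: "e \<in> fiber E p \<Longrightarrow> inv (\<psi> p) (r *\<^sub>R e) = r *\<^sub>R inv (\<psi> p) e"
proof -
  note l = triv_linear[OF assms] and i = triv_inj[OF assms] and ra = triv_range[OF assms]
  show r: "\<psi> p (inv (\<psi> p) e) = e" if "e \<in> fiber E p" for e
    using that f_inv_into_f[of e "\<psi> p" UNIV] by (simp add: ra)
  have left: "inv (\<psi> p) (\<psi> p w) = w" for w using i by simp
  show "inv (\<psi> p) (e + e') = inv (\<psi> p) e + inv (\<psi> p) e'"
    if "e \<in> fiber E p" "e' \<in> fiber E p"
    using left[of "inv (\<psi> p) e + inv (\<psi> p) e'"] that by (simp add: linear_add[OF l] r)
  show "inv (\<psi> p) (r *\<^sub>R e) = r *\<^sub>R inv (\<psi> p) e" if "e \<in> fiber E p"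
    using left[of "r *\<^sub>R inv (\<psi> p) e"] that by (simp add: linear_cmul[OF l] r)
qed

abbreviation smooth_sec where "smooth_sec \<equiv> smooth_section A E"

lemma sec_fiber: "smooth_sec U s \<Longrightarrow> p \<in> U \<Longrightarrow> s p \<in> fiber E p"
  by (simp add: smooth_section_def)

lemma sec_triv:
  "smooth_sec U s \<Longrightarrow> (V, \<psi>) \<in> trivs E \<Longrightarrow> smooth_map A (U \<inter> V) (\<lambda>p. inv (\<psi> p) (s p))"
  unfolding smooth_section_def by blast

lemma smooth_secI:
  assumes "\<And>p. p \<in> U \<Longrightarrow> s p \<in> fiber E p"
    and "\<And>V \<psi>. (V, \<psi>) \<in> trivs E \<Longrightarrow> smooth_map A (U \<inter> V) (\<lambda>p. inv (\<psi> p) (s p))"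
  shows "smooth_sec U s"
  using assms unfolding smooth_section_def by blast

lemma sec_cong:
  assumes "open U" "\<And>q. q \<in> U \<Longrightarrow> s q = t q" "smooth_sec U s"
  shows "smooth_sec U t"
proof (rule smooth_secI)
  show "t p \<in> fiber E p" if "p \<in> U" for p
    using assms(2)[OF that] sec_fiber[OF assms(3) that] by simp
  fix V \<psi> assume V: "(V, \<psi>) \<in> trivs E"
  show "smooth_map A (U \<inter> V) (\<lambda>p. inv (\<psi> p) (t p))"
    by (rule smooth_map_cong[OF _ _ sec_triv[OF assms(3) V]])
      (use assms(1,2) triv_open[OF V] in auto)
qed

lemma sec_add:
  assumes "open U" "smooth_sec U s" "smooth_sec U t"
  shows "smooth_sec U (\<lambda>q. s q + t q)"
proof (rule smooth_secI)
  show "s p + t p \<in> fiber E p" if "p \<in> U" for p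
    using assms that by (simp add: sec_fiber)
  fix V \<psi> assume V: "(V, \<psi>) \<in> trivs E"
  have o: "open (U \<inter> V)" using assms(1) triv_open[OF V] by (rule open_Int)
  show "smooth_map A (U \<inter> V) (\<lambda>p. inv (\<psi> p) (s p + t p))"
    by (rule smooth_map_cong[OF o _ smooth_map_add[OF o sec_triv[OF assms(2) V] sec_triv[OF assms(3) V]]])
      (use assms sec_fiber in \<open>auto simp: triv_inv_add[OF V]\<close>)
qed

lemma sec_scaleR:
  assumes "open U" "smooth_map A U f" "smooth_sec U s"
  shows "smooth_sec U (\<lambda>q. f q *\<^sub>R s q)"
proof (rule smooth_secI)
  show "f p *\<^sub>R s p \<in> fiber E p" if "p \<in> U" for p
    using assms that by (simp add: sec_fiber)
  fix V \<psi> assume V: "(V, \<psi>) \<in> trivs E"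
  have o: "open (U \<inter> V)" using assms(1) triv_open[OF V] by (rule open_Int)
  have f: "smooth_map A (U \<inter> V) f" using smooth_map_subset[OF assms(2)] by blast
  show "smooth_map A (U \<inter> V) (\<lambda>p. inv (\<psi> p) (f p *\<^sub>R s p))"
    by (rule smooth_map_cong[OF o _ smooth_map_scaleR[OF o f sec_triv[OF assms(3) V]]])
      (use assms sec_fiber in \<open>auto simp: triv_inv_scaleR[OF V]\<close>)
qed

lemma sec_scaleR_const: "open U \<Longrightarrow> smooth_sec U s \<Longrightarrow> smooth_sec U (\<lambda>q. r *\<^sub>R s q)"
  using sec_scaleR[OF _ smooth_map_const] by blast

lemma sec_minus: "open U \<Longrightarrow> smooth_sec U s \<Longrightarrow> smooth_sec U (\<lambda>q. - s q)"
  using sec_scaleR_const[of U s "-1"] by simp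

lemma sec_diff:
  "open U \<Longrightarrow> smooth_sec U s \<Longrightarrow> smooth_sec U t \<Longrightarrow> smooth_sec U (\<lambda>q. s q - t q)"
  using sec_add[OF _ _ sec_minus, of U s t] by simp

lemma End_fiber [simp]: "End_section A E L \<Longrightarrow> e \<in> fiber E p \<Longrightarrow> L p e \<in> fiber E p"
  by (simp add: End_section_def)

lemma End_add:
  "End_section A E L \<Longrightarrow> e \<in> fiber E p \<Longrightarrow> e' \<in> fiber E p \<Longrightarrow> L p (e + e') = L p e + L p e'"
  by (simp add: End_section_def)

lemma End_scaleR: "End_section A E L \<Longrightarrow> e \<in> fiber E p \<Longrightarrow> L p (r *\<^sub>R e) = r *\<^sub>R L p e"
  by (simp add: End_section_def)

lemma End_minus: "End_section A E L \<Longrightarrow> e \<in> fiber E p \<Longrightarrow> L p (- e) = - L p e"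
  using End_scaleR[of L e p "-1"] by simp

lemma End_diff:
  "End_section A E L \<Longrightarrow> e \<in> fiber E p \<Longrightarrow> e' \<in> fiber E p \<Longrightarrow> L p (e - e') = L p e - L p e'"
  using End_add[of L e p "- e'"] by (simp add: End_minus)

lemma End_triv:
  "End_section A E L \<Longrightarrow> (V, \<psi>) \<in> trivs E \<Longrightarrow> smooth_map A V (\<lambda>p. inv (\<psi> p) (L p (\<psi> p w)))"
  unfolding End_section_def by blast

lemma linear_triv_End:
  assumes "End_section A E L" "(V, \<psi>) \<in> trivs E" "p \<in> V"
  shows "linear (\<lambda>w. inv (\<psi> p) (L p (\<psi> p w)))"
proof -
  have f: "\<psi> p w \<in> fiber E p" for w using triv_range[OF assms(2,3)] by blast
  show ?thesis
    by (rule linearI) (simp_all add: f assms(1) linear_add[OF triv_linear[OF assms(2,3)]]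
        linear_cmul[OF triv_linear[OF assms(2,3)]] End_add End_scaleR
        triv_inv_add[OF assms(2,3)] triv_inv_scaleR[OF assms(2,3)])
qed

text \<open>In a trivialisation an endomorphism acts by a smooth matrix, the columns of which are the
  images of the constant sections.\<close>

lemma sec_End:
  assumes "open U" "End_section A E L" "smooth_sec U s"
  shows "smooth_sec U (\<lambda>q. L q (s q))"
proof (rule smooth_secI)
  show "L p (s p) \<in> fiber E p" if "p \<in> U" for p
    using assms that by (simp add: sec_fiber)
  fix V \<psi> assume V: "(V, \<psi>) \<in> trivs E"
  have o: "open (U \<inter> V)" using assms(1) triv_open[OF V] by (rule open_Int)
  have "smooth_map A (U \<inter> V) (\<lambda>p. \<Sum>b\<in>Basis. (inv (\<psi> p) (s p) \<bullet> b) *\<^sub>R inv (\<psi> p) (L p (\<psi> p b)))"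
  proof (intro smooth_map_sum[OF o] smooth_map_scaleR[OF o])
    fix b :: "real^'r"
    show "smooth_map A (U \<inter> V) (\<lambda>p. inv (\<psi> p) (s p) \<bullet> b)"
      using smooth_map_linear_image[OF o bounded_linear_inner_left sec_triv[OF assms(3) V]] .
    show "smooth_map A (U \<inter> V) (\<lambda>p. inv (\<psi> p) (L p (\<psi> p b)))"
      using smooth_map_subset[OF End_triv[OF assms(2) V]] by blast
  qed
  then show "smooth_map A (U \<inter> V) (\<lambda>p. inv (\<psi> p) (L p (s p)))"
  proof (rule smooth_map_cong[OF o, rotated])
    fix p assume p: "p \<in> U \<inter> V"
    let ?w = "inv (\<psi> p) (s p)"
    note l = linear_triv_End[OF assms(2) V, of p]
    have "inv (\<psi> p) (L p (s p)) = inv (\<psi> p) (L p (\<psi> p (\<Sum>b\<in>Basis. (?w \<bullet> b) *\<^sub>R b)))"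
      using p sec_fiber[OF assms(3)] by (simp add: euclidean_representation triv_inv_right[OF V])
    also have "\<dots> = (\<Sum>b\<in>Basis. (?w \<bullet> b) *\<^sub>R inv (\<psi> p) (L p (\<psi> p b)))"
      using p by (subst linear_sum[OF l]) (auto simp: linear_cmul[OF l])
    finally show "(\<Sum>b\<in>Basis. (?w \<bullet> b) *\<^sub>R inv (\<psi> p) (L p (\<psi> p b))) = inv (\<psi> p) (L p (s p))"
      by simp
  qed
qed

lemma End_sectionI:
  assumes "\<And>p e. e \<in> fiber E p \<Longrightarrow> L p e \<in> fiber E p"
    and "\<And>p e e'. e \<in> fiber E p \<Longrightarrow> e' \<in> fiber E p \<Longrightarrow> L p (e + e') = L p e + L p e'"
    and "\<And>p e r. e \<in> fiber E p \<Longrightarrow> L p (r *\<^sub>R e) = r *\<^sub>R L p e"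
    and "\<And>V \<psi> w. (V, \<psi>) \<in> trivs E \<Longrightarrow> smooth_map A V (\<lambda>p. inv (\<psi> p) (L p (\<psi> p w)))"
  shows "End_section A E L"
  using assms unfolding End_section_def by blast

lemma End_section_add:
  assumes L: "End_section A E L" and N: "End_section A E N"
  shows "End_section A E (\<lambda>p e. L p e + N p e)"
proof (rule End_sectionI)
  fix V \<psi> w assume V: "(V, \<psi>) \<in> trivs E"
  note o = triv_open[OF V]
  have f: "\<psi> p w \<in> fiber E p" if "p \<in> V" for p using triv_range[OF V that] by blast
  show "smooth_map A V (\<lambda>p. inv (\<psi> p) (L p (\<psi> p w) + N p (\<psi> p w)))"
    by (rule smooth_map_cong[OF o _ smooth_map_add[OF o End_triv[OF L V] End_triv[OF N V]]])
      (simp add: triv_inv_add[OF V] f L N)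
qed (auto simp: L N End_add End_scaleR algebra_simps)

lemma End_section_scaleR:
  assumes L: "End_section A E L"
  shows "End_section A E (\<lambda>p e. r *\<^sub>R L p e)"
proof (rule End_sectionI)
  fix V \<psi> w assume V: "(V, \<psi>) \<in> trivs E"
  note o = triv_open[OF V]
  have f: "\<psi> p w \<in> fiber E p" if "p \<in> V" for p using triv_range[OF V that] by blast
  show "smooth_map A V (\<lambda>p. inv (\<psi> p) (r *\<^sub>R L p (\<psi> p w)))"
    by (rule smooth_map_cong[OF o _ smooth_map_linear_image[OF o
            bounded_linear_scaleR_right[of r] End_triv[OF L V, of w]]])
      (simp add: triv_inv_scaleR[OF V] f L)
qed (auto simp: L End_add End_scaleR algebra_simps)

lemma End_section_minus: "End_section A E L \<Longrightarrow> End_section A E (\<lambda>p e. - L p e)"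
  using End_section_scaleR[of L "-1"] by simp

lemma End_section_diff:
  "End_section A E L \<Longrightarrow> End_section A E N \<Longrightarrow> End_section A E (\<lambda>p e. L p e - N p e)"
  using End_section_add[OF _ End_section_minus, of L N] by simp

lemma C_section_minus:
  assumes "C_section A E L"
  shows "C_section A E (\<lambda>p e. - L p e)"
  using assms End_section_minus by (auto simp: C_section_def End_minus)

end

section \<open>Connections and their complexification\<close>

lemma nablaC_pair:
  "nablaC D p (x, y) (\<lambda>q. (a q, b q)) = (D p x a - D p y b, D p x b + D p y a)"
  by (simp add: nablaC_def)

lemma nablaC_eq:
  "nablaC D p X s = (D p (fst X) (\<lambda>q. fst (s q)) - D p (snd X) (\<lambda>q. snd (s q)),
    D p (fst X) (\<lambda>q. snd (s q)) + D p (snd X) (\<lambda>q. fst (s q)))"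
  by (simp add: nablaC_def Let_def)

context smooth_bundle
begin

lemma smooth_vector_fieldC_proj01:
  assumes U: "open U" and X: "smooth_vector_fieldC A U X"
  obtains x where "smooth_vector_field A U x" "\<And>q. proj01 (X q) = (x q, cxI (x q))"
proof
  let ?x = "\<lambda>q. (1/2) *\<^sub>R (fst (X q) - cxI (snd (X q)))"
  show "smooth_vector_field A U ?x"
    using X unfolding smooth_vector_fieldC_def
    by (intro smooth_vector_field_scaleR smooth_vector_field_diff smooth_vector_field_cxI U) auto
  show "proj01 (X q) = (?x q, cxI (?x q))" for q by (simp add: proj01_eq Let_def)
qed

end

locale bundle_connection = smooth_bundle A E
  for A :: "('m::{t2_space,second_countable_topology}, 'd::finite) chart set"
    and E :: "('m, 'e::real_vector, 'r::finite) vbundle" +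
  fixes D :: "('m, 'd, 'e) covariant_deriv"
  assumes connection: "connection A E D"
begin

context
  fixes U s
  assumes U: "open U" and s: "smooth_sec U s"
begin

lemma conn_rules:
  shows conn_smooth: "smooth_vector_field A U X \<Longrightarrow> smooth_sec U (\<lambda>p. D p (X p) s)"
    and conn_linear: "p \<in> U \<Longrightarrow> linear (\<lambda>v. D p v s)"
    and conn_fiber: "p \<in> U \<Longrightarrow> D p v s \<in> fiber E p"
    and conn_add: "p \<in> U \<Longrightarrow> smooth_sec U t \<Longrightarrow> D p v (\<lambda>q. s q + t q) = D p v s + D p v t"
    and conn_Leibniz: "p \<in> U \<Longrightarrow> smooth_map A U f \<Longrightarrow>
      D p v (\<lambda>q. f q *\<^sub>R s q) = tderiv A p v f *\<^sub>R s p + f p *\<^sub>R D p v s"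
    and conn_cong: "p \<in> U \<Longrightarrow> (\<And>q. q \<in> U \<Longrightarrow> t q = s q) \<Longrightarrow> D p v t = D p v s"
  using connection[unfolded connection_def, rule_format, OF U s] by blast+

lemma conn_dir_add: "p \<in> U \<Longrightarrow> D p (v + w) s = D p v s + D p w s"
  and conn_dir_diff: "p \<in> U \<Longrightarrow> D p (v - w) s = D p v s - D p w s"
  and conn_dir_minus: "p \<in> U \<Longrightarrow> D p (- v) s = - D p v s"
  and conn_dir_scaleR: "p \<in> U \<Longrightarrow> D p (r *\<^sub>R v) s = r *\<^sub>R D p v s"
  and conn_dir_0: "p \<in> U \<Longrightarrow> D p 0 s = 0"
  using linear_add[OF conn_linear] linear_diff[OF conn_linear] linear_neg[OF conn_linear]
    linear_cmul[OF conn_linear] linear_0[OF conn_linear] by auto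

lemma conn_scaleR: "p \<in> U \<Longrightarrow> D p v (\<lambda>q. r *\<^sub>R s q) = r *\<^sub>R D p v s"
  using conn_Leibniz[OF _ smooth_map_const, of p v r] by simp

lemma conn_minus: "p \<in> U \<Longrightarrow> D p v (\<lambda>q. - s q) = - D p v s"
  using conn_scaleR[of p v "-1"] by simp

end

lemma conn_diff:
  "open U \<Longrightarrow> smooth_sec U s \<Longrightarrow> smooth_sec U t \<Longrightarrow> p \<in> U \<Longrightarrow>
    D p v (\<lambda>q. s q - t q) = D p v s - D p v t"
  using conn_add[of U s p "\<lambda>q. - t q" v] by (simp add: sec_minus conn_minus)

lemma curvature_minus_right:
  assumes U: "open U" "p \<in> U" and X: "smooth_vector_field A U X" and Y: "smooth_vector_field A U Y"
    and s: "smooth_sec U s"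
  shows "curvature A D X (\<lambda>q. - Y q) s p = - curvature A D X Y s p"
proof -
  have "D p (X p) (\<lambda>q. D q (- Y q) s) = D p (X p) (\<lambda>q. - D q (Y q) s)"
    by (rule conn_cong[OF U(1) sec_minus[OF U(1) conn_smooth[OF U(1) s Y]] U(2)])
      (rule conn_dir_minus[OF U(1) s])
  then show ?thesis
    by (simp add: curvature_def lie_bracket_minus_right[OF U(1) Y X U(2)] conn_dir_minus[OF U(1) _ U(2)]
        s conn_minus[OF U(1) conn_smooth[OF U(1) s Y] U(2)] conn_smooth[OF U(1) s X])
qed

text \<open>The curvature of the complex-linear extension of \<open>\<nabla>\<close>, on \<open>X = x + \<i> x'\<close> and \<open>Y = y + \<i> y'\<close>: by
  complex bilinearity it is \<open>R(x,y) - R(x',y') + \<i> (R(x,y') + R(x',y))\<close>, applied to \<open>s + \<i> t\<close>.\<close>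

lemma curvature_nablaC:
  assumes U: "open U" "p \<in> U"
    and x: "smooth_vector_field A U x" "smooth_vector_field A U x'"
    and y: "smooth_vector_field A U y" "smooth_vector_field A U y'"
    and s: "smooth_sec U s" "smooth_sec U t"
  shows "nablaC D p (x p, x' p) (\<lambda>q. nablaC D q (y q, y' q) (\<lambda>q. (s q, t q)))
      - nablaC D p (y p, y' p) (\<lambda>q. nablaC D q (x q, x' q) (\<lambda>q. (s q, t q)))
      - nablaC D p (lie_bracketC A (\<lambda>q. (x q, x' q)) (\<lambda>q. (y q, y' q)) p) (\<lambda>q. (s q, t q))
    = (curvature A D x y s p - curvature A D x' y' s p - (curvature A D x y' t p + curvature A D x' y t p),
       curvature A D x y t p - curvature A D x' y' t p + (curvature A D x y' s p + curvature A D x' y s p))"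
  by (simp add: nablaC_pair lie_bracketC_def Let_def curvature_def U s x y
      conn_diff[OF U(1) _ _ U(2)] conn_add[OF U(1) _ U(2)] conn_smooth[OF U(1)]
      conn_dir_add[OF U(1) _ U(2)] conn_dir_diff[OF U(1) _ U(2)] algebra_simps)

end

locale bundle_connection_11 = bundle_connection +
  assumes curvature_type_11: "curvature_type_11 A E D"
begin

text \<open>For \<open>X = x + \<i> Ix\<close> and \<open>Y = y + \<i> Iy\<close> the curvature is
  \<open>R(x,y) - R(Ix,Iy) + \<i> (R(x,Iy) + R(Ix,y))\<close>. Both parts vanish by type (1,1), the second one
  because \<open>R(x,Iy) = R(Ix,-y)\<close>.\<close>

lemma curvature_nablaC_01:
  assumes U: "open U" "p \<in> U"
    and x: "smooth_vector_field A U x" and y: "smooth_vector_field A U y"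
    and s: "smooth_sec U s" "smooth_sec U t"
  shows "nablaC D p (x p, cxI (x p)) (\<lambda>q. nablaC D q (y q, cxI (y q)) (\<lambda>q. (s q, t q)))
      - nablaC D p (y p, cxI (y p)) (\<lambda>q. nablaC D q (x q, cxI (x q)) (\<lambda>q. (s q, t q)))
      - nablaC D p (lie_bracketC A (\<lambda>q. (x q, cxI (x q))) (\<lambda>q. (y q, cxI (y q))) p) (\<lambda>q. (s q, t q))
    = 0"
proof -
  have type: "curvature A D (\<lambda>q. cxI (v q)) (\<lambda>q. cxI (w q)) s p = curvature A D v w s p"
    if "smooth_vector_field A U v" "smooth_vector_field A U w" "smooth_sec U s" for v w s
    using curvature_type_11 that U unfolding curvature_type_11_def by blast
  note I = smooth_vector_field_cxI[OF U(1)]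
  have "curvature A D x (\<lambda>q. cxI (y q)) s p = - curvature A D (\<lambda>q. cxI (x q)) y s p"
    if "smooth_sec U s" for s
    using type[OF x I[OF y] that] curvature_minus_right[OF U I[OF x] y that] by simp
  then show ?thesis
    by (simp only: curvature_nablaC[OF U x I[OF x] y I[OF y] s])
      (simp add: type[OF x y] s zero_prod_def)
qed

text \<open>Linearity, locality and the Leibniz rule are those of \<open>\<nabla>\<close>. As fields of type (0,1) are closed under
  the bracket, the square of \<open>\<nabla>\<^sup>0\<^sup>,\<^sup>1\<close> is the curvature evaluated on them, which vanishes on all of
  \<open>E \<otimes> \<complex>\<close>.\<close>

lemma dbar_operator_nabla01:
  assumes stable: "\<And>U s p X. open U \<Longrightarrow> smooth_sectionC A E V U s \<Longrightarrow> p \<in> U \<Longrightarrow> nabla01 D p X s \<in> V p"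
  shows "dbar_operator A E V (nabla01 D)"
  unfolding dbar_operator_def
proof (intro allI impI conjI ballI)
  fix U s assume U: "open U" and sC: "smooth_sectionC A E V U s"
  let ?a = "\<lambda>q. fst (s q)" and ?b = "\<lambda>q. snd (s q)"
  have a: "smooth_sec U ?a" and b: "smooth_sec U ?b"
    using sC by (auto simp: smooth_sectionC_def)
  note dir = conn_dir_add[OF U] conn_dir_diff[OF U] conn_dir_scaleR[OF U] conn_dir_minus[OF U]
  {
    fix p assume p: "p \<in> U"
    show "nabla01 D p (X + Y) s = nabla01 D p X s + nabla01 D p Y s" for X Y
      by (simp add: nabla01_def nablaC_eq proj01_eq Let_def dir a b p linear_diff[OF linear_cxI]
          linear_add[OF linear_cxI] linear_cmul[OF linear_cxI] algebra_simps)
    show "nabla01 D p (cscale z X) s = cscale z (nabla01 D p X s)" for z X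
      by (simp add: nabla01_def nablaC_eq proj01_eq Let_def cscale_def dir a b p linear_diff[OF linear_cxI]
          linear_add[OF linear_cxI] linear_cmul[OF linear_cxI] algebra_simps)
    show "nabla01 D p X s = 0" if "X \<in> T10" for X
      using that by (simp add: nabla01_def nablaC_eq conn_dir_0[OF U] a b p zero_prod_def)
    show "nabla01 D p X s \<in> V p" for X
      using stable[OF U sC p] .
    show "nabla01 D p X (\<lambda>q. s q + t q) = nabla01 D p X s + nabla01 D p X t"
      if "smooth_sectionC A E V U t" for t X
      using that by (simp add: nabla01_def nablaC_eq smooth_sectionC_def conn_add[OF U] a b p)
    show "nabla01 D p X t = nabla01 D p X s" if t: "\<forall>q\<in>U. t q = s q" for t X
    proof -
      have "D p v (\<lambda>q. fst (t q)) = D p v ?a" "D p v (\<lambda>q. snd (t q)) = D p v ?b" for v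
        using t by (auto intro: conn_cong[OF U a p] conn_cong[OF U b p])
      then show ?thesis by (simp add: nabla01_def nablaC_eq)
    qed
    show "nabla01 D p X (\<lambda>q. cscale (f q) (s q)) =
      cscale (tderivC A p (proj01 X) f) (s p) + cscale (f p) (nabla01 D p X s)"
      if f: "smooth_map A U f" for f X
    proof -
      have re: "smooth_map A U (\<lambda>q. Re (f q))" and im: "smooth_map A U (\<lambda>q. Im (f q))"
        using smooth_map_linear_image[OF U bounded_linear_Re f]
          smooth_map_linear_image[OF U bounded_linear_Im f] .
      have dre: "tderiv A p v (\<lambda>q. Re (f q)) = Re (tderiv A p v f)"
        and dim: "tderiv A p v (\<lambda>q. Im (f q)) = Im (tderiv A p v f)" for v
        using tderiv_linear_image[OF f p bounded_linear_Re]
          tderiv_linear_image[OF f p bounded_linear_Im] .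
      show ?thesis
        by (simp add: nabla01_def nablaC_eq cscale_def tderivC_def prod_eq_iff
            conn_add[OF U _ p] conn_diff[OF U _ _ p] conn_Leibniz[OF U _ p] sec_scaleR[OF U]
            re im a b dre dim algebra_simps)
    qed
  }
  fix X assume X: "smooth_vector_fieldC A U X"
  obtain x where x: "smooth_vector_field A U x" and Xx: "\<And>q. proj01 (X q) = (x q, cxI (x q))"
    using smooth_vector_fieldC_proj01[OF U X] by blast
  note Ix = smooth_vector_field_cxI[OF U x]
  show "smooth_sectionC A E V U (\<lambda>p. nabla01 D p (X p) s)"
    unfolding smooth_sectionC_def
  proof (intro conjI ballI)
    show "nabla01 D p (X p) s \<in> V p" if "p \<in> U" for p using stable[OF U sC that] .
  qed (auto simp: nabla01_def nablaC_eq Xx intro!: sec_add sec_diff conn_smooth U a b x Ix)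
  fix Y p
  assume Y: "smooth_vector_fieldC A U Y" and XY: "\<forall>p\<in>U. X p \<in> T01 \<and> Y p \<in> T01" and p: "p \<in> U"
  obtain y where y: "smooth_vector_field A U y" and Yy: "\<And>q. proj01 (Y q) = (y q, cxI (y q))"
    using smooth_vector_fieldC_proj01[OF U Y] by blast
  have Xq: "X q = (x q, cxI (x q))" and Yq: "Y q = (y q, cxI (y q))" if "q \<in> U" for q
    using XY that Xx[of q] Yy[of q] by simp_all
  have "lie_bracketC A X Y p = lie_bracketC A (\<lambda>q. (x q, cxI (x q))) (\<lambda>q. (y q, cxI (y q))) p"
    by (rule lie_bracketC_cong[OF U p Xq Yq])
  moreover have "\<dots> \<in> T01" by (rule lie_bracketC_T01[OF U p x y])
  ultimately show "nabla01 D p (X p) (\<lambda>q. nabla01 D q (Y q) s)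
      - nabla01 D p (Y p) (\<lambda>q. nabla01 D q (X q) s)
      - nabla01 D p (lie_bracketC A X Y p) s = 0"
    using curvature_nablaC_01[OF U p x y a b] by (simp add: nabla01_def Xx Yy)
qed

end

section \<open>Eigenbundles and holomorphic maps between them\<close>

text \<open>Passing from \<open>L\<close> to \<open>-L\<close> exchanges the two eigenbundles, so that it suffices to study
  \<open>E\<^sup>0\<^sup>,\<^sup>1\<^sub>L\<close> for all \<open>L\<close>.\<close>

lemma E10_eq_E01: "E10 E L = E01 E (\<lambda>p e. - L p e)"
  by (auto simp: E10_def E01_def cext_def cscale_def fun_eq_iff minus_equation_iff)

context smooth_bundle
begin

lemma E01_iff:
  assumes "C_section A E L"
  shows "x \<in> E01 E L p \<longleftrightarrow> fst x \<in> fiber E p \<and> snd x = L p (fst x)"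
  using assms by (cases x) (auto simp: E01_def fiberC_def cext_def cscale_def C_section_def)

lemma C_section_End [simp]: "C_section A E L \<Longrightarrow> End_section A E L"
  by (simp add: C_section_def)

lemma C_section_square [simp]: "C_section A E L \<Longrightarrow> e \<in> fiber E p \<Longrightarrow> L p (L p e) = - e"
  by (simp add: C_section_def)

lemma E01_section:
  assumes "C_section A E L" "smooth_sectionC A E (E01 E L) U s" "q \<in> U"
  shows "snd (s q) = L q (fst (s q))"
  using assms E01_iff by (auto simp: smooth_sectionC_def)

end

text \<open>A section of \<open>E\<^sup>0\<^sup>,\<^sup>1\<^sub>L\<close> is \<open>a + \<i> L a\<close> for a real section \<open>a\<close>, and for the (0,1) direction
  \<open>v + \<i> Iv\<close> its derivative has the real part \<open>\<nabla>\<^sub>v a - \<nabla>\<^sub>I\<^sub>v (L a)\<close>.\<close>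

context bundle_connection
begin

lemma nabla01_E01:
  assumes L: "C_section A E L" and U: "open U" "p \<in> U"
    and s: "smooth_sectionC A E (E01 E L) U s" and X: "proj01 X = (v, cxI v)"
  defines "a \<equiv> \<lambda>q. fst (s q)"
  shows "nabla01 D p X s = (D p v a - D p (cxI v) (\<lambda>q. L q (a q)), D p v (\<lambda>q. L q (a q)) + D p (cxI v) a)"
proof -
  have a: "smooth_sec U a" using s by (simp add: smooth_sectionC_def a_def)
  have "D p w (\<lambda>q. snd (s q)) = D p w (\<lambda>q. L q (a q))" for w
    by (rule conn_cong[OF U(1) sec_End[OF U(1) _ a] U(2)])
      (simp_all add: E01_section[OF L s] a_def L)
  then show ?thesis by (simp add: nabla01_def nablaC_eq X a_def)
qed

lemma nabla01_E01_stable: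
  assumes L: "C_section A E L"
    and par: "\<And>U s p v. open U \<Longrightarrow> smooth_sec U s \<Longrightarrow> p \<in> U \<Longrightarrow> nabla_End D L p v s = 0"
    and U: "open U" and s: "smooth_sectionC A E (E01 E L) U s" and p: "p \<in> U"
  shows "nabla01 D p X s \<in> E01 E L p"
proof -
  obtain v where X: "proj01 X = (v, cxI v)" by (metis proj01_eq)
  define a where "a = (\<lambda>q. fst (s q))"
  have a: "smooth_sec U a" using s by (simp add: smooth_sectionC_def a_def)
  have "D p w (\<lambda>q. L q (a q)) = L p (D p w a)" for w
    using par[OF U a p] by (simp add: nabla_End_def)
  then show ?thesis
    by (simp add: nabla01_E01[OF L U p s X] fun_cong[OF a_def, symmetric] E01_iff[OF L] conn_fiber[OF U a p] L End_diff)
qed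

end

text \<open>Identifying \<open>E\<^sup>0\<^sup>,\<^sup>1\<^sub>L\<close> with \<open>E\<close> by \<open>a + \<i> L a \<mapsto> a\<close> turns holomorphy of a real endomorphism
  that intertwines \<open>L\<close> and \<open>L'\<close> into an identity between real derivatives: the real part of
  \<open>B' (P s) = P (B s)\<close>.\<close>

lemma (in smooth_bundle) holomorphic_bundle_mapI:
  assumes "bundle_connection A E D1" "bundle_connection A E D2"
    and L: "C_section A E L" and L': "C_section A E L'" and P: "End_section A E P"
    and dbar: "dbar_operator A E (E01 E L) (nabla01 D1)" "dbar_operator A E (E01 E L') (nabla01 D2)"
    and PL: "\<And>p e. e \<in> fiber E p \<Longrightarrow> P p (L p e) = L' p (P p e)"
    and comm: "\<And>U a p v. open U \<Longrightarrow> smooth_sec U a \<Longrightarrow> p \<in> U \<Longrightarrow>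
      D2 p v (\<lambda>q. P q (a q)) - D2 p (cxI v) (\<lambda>q. P q (L q (a q))) =
      P p (D1 p v a - D1 p (cxI v) (\<lambda>q. L q (a q)))"
  shows "holomorphic_bundle_map A E (E01 E L) (nabla01 D1) (E01 E L') (nabla01 D2) (\<lambda>p. cext (P p))"
proof -
  interpret D1: bundle_connection A E D1 by fact
  interpret D2: bundle_connection A E D2 by fact
  have smooth: "smooth_sectionC A E (E01 E L') U (\<lambda>p. cext (P p) (s p))"
    if "open U" "smooth_sectionC A E (E01 E L) U s" for U s
    using that sec_End[OF that(1) P, of "\<lambda>p. fst (s p)"] sec_End[OF that(1) P, of "\<lambda>p. snd (s p)"]
    unfolding smooth_sectionC_def by (simp add: cext_def E01_iff[OF L] E01_iff[OF L'] P PL)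
  have hol: "nabla01 D2 p X (\<lambda>q. cext (P q) (s q)) = cext (P p) (nabla01 D1 p X s)"
    if U: "open U" "p \<in> U" and s: "smooth_sectionC A E (E01 E L) U s" for U s p X
  proof -
    obtain v where X: "proj01 X = (v, cxI v)" by (metis proj01_eq)
    define a where "a = (\<lambda>q. fst (s q))"
    have a: "smooth_sec U a" using s by (simp add: smooth_sectionC_def a_def)
    note La = sec_End[OF U(1) C_section_End[OF L] a]
    have Pa: "smooth_sec U (\<lambda>q. P q (a q))" "smooth_sec U (\<lambda>q. P q (L q (a q)))"
      using sec_End[OF U(1) P] a La by auto
    have fst: "(\<lambda>q. fst (cext (P q) (s q))) = (\<lambda>q. P q (a q))" by (simp add: cext_def a_def)
    have cong: "D2 p w (\<lambda>q. L' q (P q (a q))) = D2 p w (\<lambda>q. P q (L q (a q)))" for w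
      by (rule D2.conn_cong[OF U(1) Pa(2) U(2)]) (simp add: PL sec_fiber[OF a])
    show ?thesis
      \<comment> \<open>The real and imaginary parts are the hypothesis for the directions \<open>v\<close> and \<open>Iv\<close>.\<close>
      using comm[OF U(1) a U(2), of v] comm[OF U(1) a U(2), of "cxI v"]
      unfolding D2.nabla01_E01[OF L' U smooth[OF U(1) s] X] D1.nabla01_E01[OF L U s X]
      by (simp add: fst cong cext_def fun_cong[OF a_def, symmetric] D1.conn_dir_minus[OF U(1) _ U(2)] D2.conn_dir_minus[OF U(1) _ U(2)] a Pa La add.commute)
  qed
  show ?thesis
    unfolding holomorphic_bundle_map_def
    using dbar smooth hol P
    by (auto simp: cext_def cscale_def E01_iff[OF L] E01_iff[OF L'] PL L End_add End_diff End_scaleR)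
qed

lemma holomorphic_bundle_mapD:
  assumes "holomorphic_bundle_map A E V B W B' \<Phi>"
  shows "x \<in> V p \<Longrightarrow> \<Phi> p x \<in> W p"
    and "x \<in> V p \<Longrightarrow> y \<in> V p \<Longrightarrow> \<Phi> p (x + y) = \<Phi> p x + \<Phi> p y"
    and "x \<in> V p \<Longrightarrow> \<Phi> p (cscale z x) = cscale z (\<Phi> p x)"
    and "open U \<Longrightarrow> smooth_sectionC A E V U s \<Longrightarrow> smooth_sectionC A E W U (\<lambda>p. \<Phi> p (s p))"
    and "open U \<Longrightarrow> smooth_sectionC A E V U s \<Longrightarrow> p \<in> U \<Longrightarrow>
      B' p X (\<lambda>q. \<Phi> q (s q)) = \<Phi> p (B p X s)"
    and "dbar_operator A E V B" and "dbar_operator A E W B'"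
  using assms by (simp_all add: holomorphic_bundle_map_def del: split_paired_All)

text \<open>The map \<open>\<Omega>\<close> only has to agree with the composite on the fibres: identities between
  endomorphisms of \<open>E\<close> hold there and need not extend to the ambient vector space.\<close>

lemma (in smooth_bundle) holomorphic_bundle_map_comp:
  assumes \<Phi>: "holomorphic_bundle_map A E V B W B' \<Phi>" and \<Psi>: "holomorphic_bundle_map A E W B' Z B'' \<Psi>"
    and V: "\<And>p. V p \<subseteq> fiberC E p"
    and \<Omega>: "\<And>p x. x \<in> fiberC E p \<Longrightarrow> \<Omega> p x = \<Psi> p (\<Phi> p x)"
  shows "holomorphic_bundle_map A E V B Z B'' \<Omega>"
proof -
  have \<Omega>V: "\<Omega> p x = \<Psi> p (\<Phi> p x)" if "x \<in> V p" for p x using \<Omega> V that by blast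
  have closed: "x + y \<in> fiberC E p" "cscale z x \<in> fiberC E p"
    if "x \<in> V p" "y \<in> V p" for p x y z
    using subsetD[OF V that(1)] subsetD[OF V that(2)]
    by (auto simp: fiberC_def cscale_def mem_Times_iff)
  note W = holomorphic_bundle_mapD(1-3)[OF \<Phi>] and Z = holomorphic_bundle_mapD(1-3)[OF \<Psi>]
    and s\<Phi> = holomorphic_bundle_mapD(4)[OF \<Phi>] and s\<Psi> = holomorphic_bundle_mapD(4)[OF \<Psi>]
    and B\<Phi> = holomorphic_bundle_mapD(5)[OF \<Phi>] and B\<Psi> = holomorphic_bundle_mapD(5)[OF \<Psi>]
    and BV = holomorphic_bundle_mapD(6)[OF \<Phi>] and BZ = holomorphic_bundle_mapD(7)[OF \<Psi>]
  have B_in: "B p X s \<in> V p" if "open U" "smooth_sectionC A E V U s" "p \<in> U" for U s p X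
    using BV[unfolded dbar_operator_def, rule_format, OF that(1,2)] that(3) by blast
  have B_cong: "B'' p X t = B'' p X s"
    if "open U" "smooth_sectionC A E Z U s" "p \<in> U" "\<forall>q\<in>U. t q = s q" for U s t p X
    using BZ[unfolded dbar_operator_def, rule_format, OF that(1,2)] that(3,4) by blast
  have sec: "smooth_sectionC A E Z U (\<lambda>p. \<Omega> p (s p))"
    and BO: "p \<in> U \<Longrightarrow> B'' p X (\<lambda>q. \<Omega> q (s q)) = \<Omega> p (B p X s)"
    if U: "open U" and s: "smooth_sectionC A E V U s" for U s p X
  proof -
    note sec = s\<Psi>[OF U s\<Phi>[OF U s]]
    have eq: "\<Omega> q (s q) = \<Psi> q (\<Phi> q (s q))" if "q \<in> U" for q
      using that s \<Omega>V by (simp add: smooth_sectionC_def)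
    show "smooth_sectionC A E Z U (\<lambda>p. \<Omega> p (s p))"
      using sec sec_cong[OF U, of "\<lambda>p. fst (\<Psi> p (\<Phi> p (s p)))" "\<lambda>p. fst (\<Omega> p (s p))"]
        sec_cong[OF U, of "\<lambda>p. snd (\<Psi> p (\<Phi> p (s p)))" "\<lambda>p. snd (\<Omega> p (s p))"]
      by (simp add: smooth_sectionC_def eq)
    show "B'' p X (\<lambda>q. \<Omega> q (s q)) = \<Omega> p (B p X s)" if p: "p \<in> U"
      using B_cong[OF U sec p, of "\<lambda>q. \<Omega> q (s q)"]
      by (simp add: eq B\<Psi>[OF U s\<Phi>[OF U s] p] B\<Phi>[OF U s p] \<Omega>V[OF B_in[OF U s p]])
  qed
  have lin: "\<Omega> p x \<in> Z p" "y \<in> V p \<Longrightarrow> \<Omega> p (x + y) = \<Omega> p x + \<Omega> p y"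
    "\<Omega> p (cscale z x) = cscale z (\<Omega> p x)" if x: "x \<in> V p" for p x y z
    using x \<Omega>V[OF x] \<Omega>V[of y p] \<Omega>[OF closed(1)[OF x, of y]] \<Omega>[OF closed(2)[OF x x]] W[OF x] W(1)[of y p]
      Z[OF W(1)[OF x]]
    by simp_all
  show ?thesis
    unfolding holomorphic_bundle_map_def
    by (intro conjI allI ballI impI BV BZ lin sec BO)
qed

section \<open>The twisted connection\<close>

text \<open>For recombining the halves that \<open>algebra_simps\<close> distributes over sums.\<close>

lemma half_plus_half:
  "(c / 2) *\<^sub>R x + (c / 2) *\<^sub>R x = c *\<^sub>R (x :: 'a::real_vector)"
  "(c / 2) *\<^sub>R x + ((c / 2) *\<^sub>R x + y) = c *\<^sub>R x + y"
  by (simp_all flip: scaleR_add_left add.assoc)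

locale twisted_bundle = bundle_connection_11 A E D
  for A :: "('m::{t2_space,second_countable_topology}, 'd::finite) chart set"
    and E :: "('m, 'e::real_vector, 'r::finite) vbundle"
    and D :: "('m, 'd, 'e) covariant_deriv" +
  fixes K :: "'m \<Rightarrow> 'e \<Rightarrow> 'e"
  assumes K: "C_section A E K"
    and K_nabla_K: "\<And>U s p v. open U \<Longrightarrow> smooth_sec U s \<Longrightarrow> p \<in> U \<Longrightarrow>
      K p (nabla_End D K p v s) = nabla_End D K p (cxI v) s"
begin

abbreviation D' where "D' \<equiv> twisted_connection D K"

text \<open>As \<open>\<nabla>' = 1/2 (\<nabla> - K \<nabla> K)\<close> is the part of \<open>\<nabla>\<close> that commutes with \<open>K\<close>, the difference
  \<open>\<nabla> - \<nabla>' = 1/2 (\<nabla> + K \<nabla> K)\<close> anticommutes with \<open>K\<close>. It is denoted by \<open>T\<close> in the comments.\<close>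

definition antilinear_part :: "('m, 'd, 'e) covariant_deriv" where
  "antilinear_part p v s = D p v s - D' p v s"

lemma K_rules [simp]:
  "e \<in> fiber E p \<Longrightarrow> K p e \<in> fiber E p"
  "e \<in> fiber E p \<Longrightarrow> K p (K p e) = - e"
  "e \<in> fiber E p \<Longrightarrow> e' \<in> fiber E p \<Longrightarrow> K p (e + e') = K p e + K p e'"
  "e \<in> fiber E p \<Longrightarrow> e' \<in> fiber E p \<Longrightarrow> K p (e - e') = K p e - K p e'"
  "e \<in> fiber E p \<Longrightarrow> K p (r *\<^sub>R e) = r *\<^sub>R K p e"
  "e \<in> fiber E p \<Longrightarrow> K p (- e) = - K p e"
  using K by (simp_all add: End_add End_diff End_scaleR End_minus)

lemma sec_K: "open U \<Longrightarrow> smooth_sec U s \<Longrightarrow> smooth_sec U (\<lambda>q. K q (s q))"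
  using sec_End K by simp

lemma conn_KK:
  assumes U: "open U" and s: "smooth_sec U s" and p: "p \<in> U"
  shows "D p v (\<lambda>q. K q (K q (s q))) = - D p v s"
  using conn_cong[OF U sec_minus[OF U s] p, of "\<lambda>q. K q (K q (s q))"]
  by (simp add: conn_minus[OF U s p] sec_fiber[OF s])

lemma twisted_eq:
  assumes U: "open U" and s: "smooth_sec U s" and p: "p \<in> U"
  shows "D' p v s = (1/2) *\<^sub>R (D p v s - K p (D p v (\<lambda>q. K q (s q))))"
proof -
  have "D p v s = (1/2) *\<^sub>R D p v s + (1/2) *\<^sub>R D p v s"
    by (simp flip: scaleR_add_left)
  then show ?thesis
    by (simp add: twisted_connection_def nabla_End_def conn_KK[OF U s p] algebra_simps)
qed

lemma antilinear_part_eq: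
  assumes U: "open U" and s: "smooth_sec U s" and p: "p \<in> U"
  shows "antilinear_part p v s = (1/2) *\<^sub>R (D p v s + K p (D p v (\<lambda>q. K q (s q))))"
proof -
  have "D p v s = (1/2) *\<^sub>R D p v s + (1/2) *\<^sub>R D p v s"
    by (simp flip: scaleR_add_left)
  then show ?thesis
    unfolding antilinear_part_def twisted_eq[OF U s p] by (simp add: algebra_simps)
qed

lemma twisted_parallel:
  assumes U: "open U" and s: "smooth_sec U s" and p: "p \<in> U"
  shows "D' p v (\<lambda>q. K q (s q)) = K p (D' p v s)"
  using conn_fiber[OF U s p] conn_fiber[OF U sec_K[OF U s] p]
  by (simp add: twisted_eq[OF U _ p] s sec_K[OF U] conn_KK[OF U s p])

lemma antilinear_part_anticommutes:
  assumes U: "open U" and s: "smooth_sec U s" and p: "p \<in> U"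
  shows "antilinear_part p v (\<lambda>q. K q (s q)) = - K p (antilinear_part p v s)"
  using conn_fiber[OF U s p] conn_fiber[OF U sec_K[OF U s] p]
  by (simp add: antilinear_part_eq[OF U _ p] s sec_K[OF U] conn_KK[OF U s p] algebra_simps)

text \<open>The hypothesis \<open>K (\<nabla>\<^sub>v K) = \<nabla>\<^sub>I\<^sub>v K\<close> in terms of \<open>T = 1/2 K (\<nabla>K)\<close>.\<close>

lemma antilinear_part_cxI:
  assumes U: "open U" and s: "smooth_sec U s" and p: "p \<in> U"
  shows "antilinear_part p (cxI v) s = K p (antilinear_part p v s)"
proof -
  have "antilinear_part p w s = (1/2) *\<^sub>R K p (nabla_End D K p w s)" for w
    using conn_fiber[OF U s p] conn_fiber[OF U sec_K[OF U s] p]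
    by (simp add: antilinear_part_eq[OF U s p] nabla_End_def)
  moreover have "nabla_End D K p w s \<in> fiber E p" for w
    using conn_fiber[OF U s p] conn_fiber[OF U sec_K[OF U s] p] by (simp add: nabla_End_def)
  ultimately show ?thesis using K_nabla_K[OF U s p, of v] by simp
qed

text \<open>In the Leibniz rule the two summands of \<open>1/2 (\<nabla> - K \<nabla> K)\<close> contribute half of the term
  \<open>df \<otimes> s\<close> each, because \<open>- K (df \<otimes> K s) = df \<otimes> s\<close>.\<close>

lemma connection_twisted: "connection A E D'"
  unfolding connection_def
proof (intro allI impI conjI ballI)
  fix U s assume U: "open U" and s: "smooth_sec U s"
  note Ks = sec_K[OF U s]
  {
    fix p assume p: "p \<in> U"
    note eq = twisted_eq[OF U _ p]
    show "linear (\<lambda>v. D' p v s)"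
      by (rule linearI) (simp_all add: eq s conn_dir_add[OF U _ p] conn_dir_scaleR[OF U _ p] Ks
          conn_fiber[OF U _ p] algebra_simps)
    show "D' p v s \<in> fiber E p" for v
      by (simp add: eq s conn_fiber[OF U _ p] Ks)
    show "D' p v (\<lambda>q. s q + t q) = D' p v s + D' p v t" if t: "smooth_sec U t" for v t
    proof -
      have "D p v (\<lambda>q. K q (s q + t q)) = D p v (\<lambda>q. K q (s q) + K q (t q))"
        by (rule conn_cong[OF U sec_add[OF U Ks sec_K[OF U t]] p])
          (simp add: sec_fiber[OF s] sec_fiber[OF t])
      then show ?thesis
        by (simp add: eq s t sec_add[OF U] conn_add[OF U _ p] Ks sec_K[OF U t] conn_fiber[OF U _ p]
            algebra_simps)
    qed
    show "D' p v (\<lambda>q. f q *\<^sub>R s q) = tderiv A p v f *\<^sub>R s p + f p *\<^sub>R D' p v s"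
      if f: "smooth_map A U f" for v f
    proof -
      have "D p v (\<lambda>q. K q (f q *\<^sub>R s q)) = D p v (\<lambda>q. f q *\<^sub>R K q (s q))"
        by (rule conn_cong[OF U sec_scaleR[OF U f Ks] p]) (simp add: sec_fiber[OF s])
      then show ?thesis
        using sec_fiber[OF s p]
        by (simp add: eq s sec_scaleR[OF U f] conn_Leibniz[OF U _ p f] Ks conn_fiber[OF U _ p]
            algebra_simps half_plus_half)
    qed
    show "D' p v t = D' p v s" if t: "\<forall>q\<in>U. t q = s q" for v t
    proof -
      have "smooth_sec U t" using sec_cong[OF U _ s] t by simp
      moreover have "D p v (\<lambda>q. K q (t q)) = D p v (\<lambda>q. K q (s q))"
        by (rule conn_cong[OF U Ks p]) (simp add: t)
      ultimately show ?thesis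
        using conn_cong[OF U s p, of t] t by (simp add: eq s)
    qed
  }
  fix X assume X: "smooth_vector_field A U X"
  have "smooth_sec U (\<lambda>p. (1/2) *\<^sub>R (D p (X p) s - K p (D p (X p) (\<lambda>q. K q (s q)))))"
    by (intro sec_scaleR_const sec_diff sec_K conn_smooth U s X)
  then show "smooth_sec U (\<lambda>p. D' p (X p) s)"
    by (rule sec_cong[OF U, rotated]) (simp add: twisted_eq[OF U s])
qed

sublocale twisted: bundle_connection A E D'
  by unfold_locales (rule connection_twisted)

lemma D_split: "D p v s = D' p v s + antilinear_part p v s"
  by (simp add: antilinear_part_def)

lemma D_K:
  "open U \<Longrightarrow> smooth_sec U s \<Longrightarrow> p \<in> U \<Longrightarrow>
    D p v (\<lambda>q. K q (s q)) = K p (D' p v s) - K p (antilinear_part p v s)"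
  by (simp add: D_split[of p v "\<lambda>q. K q (s q)"] twisted_parallel antilinear_part_anticommutes)

lemma antilinear_part_fiber: "open U \<Longrightarrow> smooth_sec U s \<Longrightarrow> p \<in> U \<Longrightarrow> antilinear_part p v s \<in> fiber E p"
  by (simp add: antilinear_part_def conn_fiber twisted.conn_fiber)

lemma antilinear_part_smooth:
  "open U \<Longrightarrow> smooth_sec U s \<Longrightarrow> smooth_vector_field A U X \<Longrightarrow> smooth_sec U (\<lambda>p. antilinear_part p (X p) s)"
  by (simp add: antilinear_part_def sec_diff conn_smooth twisted.conn_smooth)

lemma antilinear_part_cong: "open U \<Longrightarrow> smooth_sec U s \<Longrightarrow> p \<in> U \<Longrightarrow> (\<And>q. q \<in> U \<Longrightarrow> t q = s q) \<Longrightarrow>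
    antilinear_part p v t = antilinear_part p v s"
  by (simp add: antilinear_part_def conn_cong[of U s p t] twisted.conn_cong[of U s p t])

text \<open>Expand \<open>\<nabla>\<^sub>X \<nabla>\<^sub>Y = (\<nabla>'\<^sub>X + T\<^sub>X) (\<nabla>'\<^sub>Y + T\<^sub>Y)\<close>: as \<open>\<nabla>'\<close> commutes with \<open>K\<close> and \<open>T\<close> anticommutes with
  it, the part of \<open>\<nabla>\<^sub>X \<nabla>\<^sub>Y\<close> commuting with \<open>K\<close> is \<open>\<nabla>'\<^sub>X \<nabla>'\<^sub>Y + T\<^sub>X T\<^sub>Y\<close>.\<close>

lemma twisted_second_derivative:
  assumes U: "open U" "p \<in> U" and s: "smooth_sec U s" and Y: "smooth_vector_field A U Y"
  shows "D' p v (\<lambda>q. D' q (Y q) s) =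
      (1/2) *\<^sub>R (D p v (\<lambda>q. D q (Y q) s) - K p (D p v (\<lambda>q. D q (Y q) (\<lambda>q. K q (s q)))))
      - antilinear_part p v (\<lambda>q. antilinear_part q (Y q) s)"
proof -
  define a where "a = (\<lambda>q. D' q (Y q) s)"
  define b where "b = (\<lambda>q. antilinear_part q (Y q) s)"
  have a: "smooth_sec U a" and b: "smooth_sec U b"
    unfolding a_def b_def by (intro twisted.conn_smooth antilinear_part_smooth U s Y)+
  have s1: "D p v (\<lambda>q. D q (Y q) s) = D p v (\<lambda>q. a q + b q)"
    by (simp add: a_def b_def antilinear_part_def)
  have s2: "D p v (\<lambda>q. D q (Y q) (\<lambda>q. K q (s q))) = D p v (\<lambda>q. K q (a q) - K q (b q))"
    by (rule conn_cong[OF U(1) sec_diff[OF U(1) sec_K[OF U(1) a] sec_K[OF U(1) b]] U(2)])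
      (simp add: a_def b_def twisted_parallel[OF U(1) s] antilinear_part_anticommutes[OF U(1) s]
        D_split[where s = "\<lambda>q. K q (s q)"])
  have fib: "D' p v a \<in> fiber E p" "D' p v b \<in> fiber E p" "antilinear_part p v a \<in> fiber E p" "antilinear_part p v b \<in> fiber E p"
    using twisted.conn_fiber[OF U(1) _ U(2)] antilinear_part_fiber[OF U(1) _ U(2)] a b by auto
  have s1': "D p v (\<lambda>q. a q + b q) = D' p v a + antilinear_part p v a + (D' p v b + antilinear_part p v b)"
    by (simp add: conn_add[OF U(1) a U(2) b] D_split[of p v a] D_split[of p v b])
  have s2': "D p v (\<lambda>q. K q (a q) - K q (b q)) =
      K p (D' p v a) - K p (antilinear_part p v a) - (K p (D' p v b) - K p (antilinear_part p v b))"
    by (simp add: conn_diff[OF U(1) sec_K[OF U(1) a] sec_K[OF U(1) b] U(2)]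
        D_K[OF U(1) a U(2)] D_K[OF U(1) b U(2)])
  show ?thesis
    unfolding s1 s2 s1' s2' a_def[symmetric] b_def[symmetric]
    using fib by (simp add: algebra_simps half_plus_half half_plus_half[where c = 1, simplified])
qed

text \<open>\<open>T\<^sub>I\<^sub>v T\<^sub>I\<^sub>w = K T\<^sub>v K T\<^sub>w = - K K T\<^sub>v T\<^sub>w = T\<^sub>v T\<^sub>w\<close>\<close>

lemma antilinear_part_square_cxI:
  assumes U: "open U" "p \<in> U" and s: "smooth_sec U s" and Y: "smooth_vector_field A U Y"
  shows "antilinear_part p (cxI v) (\<lambda>q. antilinear_part q (cxI (Y q)) s) = antilinear_part p v (\<lambda>q. antilinear_part q (Y q) s)"
proof -
  note b = antilinear_part_smooth[OF U(1) s Y]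
  have "antilinear_part p (cxI v) (\<lambda>q. antilinear_part q (cxI (Y q)) s) = antilinear_part p (cxI v) (\<lambda>q. K q (antilinear_part q (Y q) s))"
    by (rule antilinear_part_cong[OF U(1) sec_K[OF U(1) b] U(2)]) (simp add: antilinear_part_cxI[OF U(1) s])
  then show ?thesis
    by (simp add: antilinear_part_anticommutes[OF U(1) b U(2)] antilinear_part_cxI[OF U(1) b U(2)] antilinear_part_fiber[OF U(1) b U(2)])
qed

text \<open>The curvature of \<open>\<nabla>'\<close> is the part of the curvature of \<open>\<nabla>\<close> commuting with \<open>K\<close>, corrected by
  the commutator of \<open>T\<close>, and the latter is of type (1,1) since \<open>T\<^sub>I\<^sub>v = K T\<^sub>v\<close>.\<close>

lemma curvature_twisted:
  assumes U: "open U" "p \<in> U" and s: "smooth_sec U s"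
    and X: "smooth_vector_field A U X" and Y: "smooth_vector_field A U Y"
  shows "curvature A D' X Y s p =
      (1/2) *\<^sub>R (curvature A D X Y s p - K p (curvature A D X Y (\<lambda>q. K q (s q)) p))
      - (antilinear_part p (X p) (\<lambda>q. antilinear_part q (Y q) s) - antilinear_part p (Y p) (\<lambda>q. antilinear_part q (X q) s))"
proof -
  note Ks = sec_K[OF U(1) s]
  have fib: "D p v s \<in> fiber E p" if "smooth_sec U s" for v s
    by (rule conn_fiber[OF U(1) that U(2)])
  show ?thesis
    using fib[OF conn_smooth[OF U(1) Ks X]] fib[OF conn_smooth[OF U(1) Ks Y]] fib[OF Ks]
    by (simp add: curvature_def twisted_second_derivative[OF U s] X Y twisted_eq[OF U(1) s U(2)]
        algebra_simps)
qed

lemma curvature_type_11_twisted: "curvature_type_11 A E D'"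
  unfolding curvature_type_11_def
proof (intro allI impI ballI)
  fix U X Y s p
  assume U: "open U" and X: "smooth_vector_field A U X" and Y: "smooth_vector_field A U Y"
    and s: "smooth_sec U s" and p: "p \<in> U"
  note I = smooth_vector_field_cxI[OF U]
  have "curvature A D (\<lambda>q. cxI (X q)) (\<lambda>q. cxI (Y q)) t p = curvature A D X Y t p"
    if "smooth_sec U t" for t
    using curvature_type_11 U X Y that p unfolding curvature_type_11_def by blast
  then show "curvature A D' (\<lambda>q. cxI (X q)) (\<lambda>q. cxI (Y q)) s p = curvature A D' X Y s p"
    by (simp add: curvature_twisted[OF U p s] X Y I s sec_K[OF U s] antilinear_part_square_cxI[OF U p s])
qed

sublocale twisted: bundle_connection_11 A E D'
  by unfold_locales (rule curvature_type_11_twisted)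

end

section \<open>The holomorphic maps between the eigenbundles of J and K\<close>

context twisted_bundle
begin

lemma dbar_E01_K: "dbar_operator A E (E01 E K) (nabla01 D')"
  and dbar_E10_K: "dbar_operator A E (E10 E K) (nabla01 D')"
proof -
  have par: "nabla_End D' K p v s = 0" if "open U" "smooth_sec U s" "p \<in> U" for U s p v
    using that by (simp add: nabla_End_def twisted_parallel)
  then show "dbar_operator A E (E01 E K) (nabla01 D')"
    by (intro twisted.dbar_operator_nabla01 twisted.nabla01_E01_stable K)
  have "nabla_End D' (\<lambda>p e. - K p e) p v s = 0" if "open U" "smooth_sec U s" "p \<in> U" for U s p v
    using that by (simp add: nabla_End_def twisted.conn_minus[OF that(1) sec_K[OF that(1,2)]] twisted_parallel)
  then show "dbar_operator A E (E10 E K) (nabla01 D')"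
    unfolding E10_eq_E01
    by (intro twisted.dbar_operator_nabla01 twisted.nabla01_E01_stable C_section_minus K)
qed

lemma bundle_connections: "bundle_connection A E D" "bundle_connection A E D'"
  by unfold_locales

context
  fixes J
  assumes J: "C_section A E J"
    and J_parallel: "\<And>U s p v. open U \<Longrightarrow> smooth_sec U s \<Longrightarrow> p \<in> U \<Longrightarrow> nabla_End D J p v s = 0"
begin

lemma J_rules:
  "e \<in> fiber E p \<Longrightarrow> J p e \<in> fiber E p"
  "e \<in> fiber E p \<Longrightarrow> J p (J p e) = - e"
  "e \<in> fiber E p \<Longrightarrow> e' \<in> fiber E p \<Longrightarrow> J p (e + e') = J p e + J p e'"
  "e \<in> fiber E p \<Longrightarrow> e' \<in> fiber E p \<Longrightarrow> J p (e - e') = J p e - J p e'"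
  "e \<in> fiber E p \<Longrightarrow> J p (- e) = - J p e"
  using J by (simp_all add: End_add End_diff End_scaleR End_minus)

lemma D_J: "open U \<Longrightarrow> smooth_sec U s \<Longrightarrow> p \<in> U \<Longrightarrow> D p v (\<lambda>q. J q (s q)) = J p (D p v s)"
  using J_parallel by (simp add: nabla_End_def)

lemma sec_J: "open U \<Longrightarrow> smooth_sec U s \<Longrightarrow> smooth_sec U (\<lambda>q. J q (s q))"
  using sec_End J by simp

lemma dbar_E01_J: "dbar_operator A E (E01 E J) (nabla01 D)"
  and dbar_E10_J: "dbar_operator A E (E10 E J) (nabla01 D)"
proof -
  show "dbar_operator A E (E01 E J) (nabla01 D)"
    by (intro dbar_operator_nabla01 nabla01_E01_stable J J_parallel)
  have "nabla_End D (\<lambda>p e. - J p e) p v s = 0" if "open U" "smooth_sec U s" "p \<in> U" for U s p v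
    using that by (simp add: nabla_End_def conn_minus[OF that(1) sec_J[OF that(1,2)]] D_J)
  then show "dbar_operator A E (E10 E J) (nabla01 D)"
    unfolding E10_eq_E01 by (intro dbar_operator_nabla01 nabla01_E01_stable C_section_minus J)
qed

lemma End_J_plus_K: "End_section A E (\<lambda>p e. J p e + K p e)"
  and End_J_minus_K: "End_section A E (\<lambda>p e. J p e - K p e)"
  using End_section_add End_section_diff J K by auto

text \<open>Here and in the three analogous lemmas below, all derivatives are expressed through \<open>\<nabla>'\<close> and \<open>T\<close>
  by \<open>\<nabla>J = 0\<close> and \<open>\<nabla>'K = 0\<close>. The terms in the direction \<open>Iv\<close> then cancel the \<open>T\<close> terms in the direction
  \<open>v\<close>, because \<open>T\<^sub>I\<^sub>v = K T\<^sub>v\<close> and, on sections of the source \<open>E\<^sup>0\<^sup>,\<^sup>1\<^sub>K\<close>, also \<open>T K = - K T\<close>.\<close>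

lemma J_plus_K_01:
  "holomorphic_bundle_map A E (E01 E K) (nabla01 D') (E01 E J) (nabla01 D)
     (\<lambda>p. cext (\<lambda>e. J p e + K p e))"
proof (rule holomorphic_bundle_mapI[OF bundle_connections(2,1) K J End_J_plus_K dbar_E01_K dbar_E01_J])
  show "J p (K p e) + K p (K p e) = J p (J p e + K p e)" if "e \<in> fiber E p" for p e
    using that by (simp add: J_rules)
next
  fix U a p v assume U: "open U" and a: "smooth_sec U a" and p: "p \<in> U"
  note fib = twisted.conn_fiber[OF U a p] antilinear_part_fiber[OF U a p]
  note secs = a sec_J[OF U] sec_K[OF U]
  show "D p v (\<lambda>q. J q (a q) + K q (a q)) - D p (cxI v) (\<lambda>q. J q (K q (a q)) + K q (K q (a q))) =
      J p (D' p v a - D' p (cxI v) (\<lambda>q. K q (a q))) + K p (D' p v a - D' p (cxI v) (\<lambda>q. K q (a q)))"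
    by (simp add: conn_add[OF U _ p] secs D_J[OF U _ p] D_K[OF U _ p] D_split[of p _ a]
        twisted_parallel[OF U _ p] antilinear_part_anticommutes[OF U _ p] antilinear_part_cxI[OF U _ p] fib J_rules algebra_simps)
qed

lemma J_minus_K_01:
  "holomorphic_bundle_map A E (E01 E K) (nabla01 D') (E10 E J) (nabla01 D)
     (\<lambda>p. cext (\<lambda>e. J p e - K p e))"
  unfolding E10_eq_E01[of E J]
proof (rule holomorphic_bundle_mapI[OF bundle_connections(2,1) K C_section_minus[OF J] End_J_minus_K dbar_E01_K
      dbar_E10_J[unfolded E10_eq_E01]])
  show "J p (K p e) - K p (K p e) = - J p (J p e - K p e)" if "e \<in> fiber E p" for p e
    using that by (simp add: J_rules)
next
  fix U a p v assume U: "open U" and a: "smooth_sec U a" and p: "p \<in> U"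
  note fib = twisted.conn_fiber[OF U a p] antilinear_part_fiber[OF U a p]
  note secs = a sec_J[OF U] sec_K[OF U]
  show "D p v (\<lambda>q. J q (a q) - K q (a q)) - D p (cxI v) (\<lambda>q. J q (K q (a q)) - K q (K q (a q))) =
      J p (D' p v a - D' p (cxI v) (\<lambda>q. K q (a q))) - K p (D' p v a - D' p (cxI v) (\<lambda>q. K q (a q)))"
    by (simp add: conn_diff[OF U _ _ p] secs D_J[OF U _ p] D_K[OF U _ p] D_split[of p _ a]
        twisted_parallel[OF U _ p] antilinear_part_anticommutes[OF U _ p] antilinear_part_cxI[OF U _ p] fib J_rules algebra_simps)
qed

text \<open>\<open>\<nabla>'\<close> need not commute with \<open>J\<close>; the extra terms are the failure of \<open>T\<close> to do so.\<close>

lemma twisted_J: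
  assumes U: "open U" and s: "smooth_sec U s" and p: "p \<in> U"
  shows "D' p v (\<lambda>q. J q (s q)) = J p (D' p v s) + J p (antilinear_part p v s) - antilinear_part p v (\<lambda>q. J q (s q))"
proof -
  have "D' p v (\<lambda>q. J q (s q)) = J p (D p v s) - antilinear_part p v (\<lambda>q. J q (s q))"
    using D_J[OF U s p] by (simp add: antilinear_part_def)
  then show ?thesis
    by (simp add: D_split[where s = s] J_rules twisted.conn_fiber[OF U s p] antilinear_part_fiber[OF U s p])
qed

lemma J_plus_K_10:
  "holomorphic_bundle_map A E (E10 E J) (nabla01 D) (E10 E K) (nabla01 D')
     (\<lambda>p. cext (\<lambda>e. J p e + K p e))"
  unfolding E10_eq_E01
proof (rule holomorphic_bundle_mapI[OF bundle_connections(1,2) C_section_minus[OF J] C_section_minus[OF K]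
      End_J_plus_K dbar_E10_J[unfolded E10_eq_E01] dbar_E10_K[unfolded E10_eq_E01]])
  show "J p (- J p e) + K p (- J p e) = - K p (J p e + K p e)" if "e \<in> fiber E p" for p e
    using that by (simp add: J_rules)
next
  fix U a p v assume U: "open U" and a: "smooth_sec U a" and p: "p \<in> U"
  show "D' p v (\<lambda>q. J q (a q) + K q (a q)) - D' p (cxI v) (\<lambda>q. J q (- J q (a q)) + K q (- J q (a q))) =
      J p (D p v a - D p (cxI v) (\<lambda>q. - J q (a q))) + K p (D p v a - D p (cxI v) (\<lambda>q. - J q (a q)))"
  proof -
    note Ja = sec_J[OF U a] and KJa = sec_K[OF U sec_J[OF U a]]
    note fib = twisted.conn_fiber[OF U _ p] antilinear_part_fiber[OF U _ p]
    \<comment> \<open>\<open>J\<^sup>2 = -1\<close> holds on the fibres only, so these two sections agree only on \<open>U\<close>.\<close>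
    have "D' p (cxI v) (\<lambda>q. J q (- J q (a q)) + K q (- J q (a q))) = D' p (cxI v) (\<lambda>q. a q - K q (J q (a q)))"
      by (rule twisted.conn_cong[OF U sec_diff[OF U a KJa] p])
        (simp add: J_rules sec_fiber[OF a])
    then show ?thesis
      by (simp add: twisted.conn_add[OF U _ p] twisted.conn_diff[OF U _ _ p] twisted.conn_minus[OF U _ p]
          conn_minus[OF U _ p] twisted_J[OF U a p] twisted_parallel[OF U _ p] D_J[OF U a p]
          D_split[of p _ a] antilinear_part_cxI[OF U _ p] sec_K[OF U] sec_minus[OF U] a Ja KJa fib J_rules algebra_simps)
  qed
qed

lemma J_minus_K_10:
  "holomorphic_bundle_map A E (E01 E J) (nabla01 D) (E10 E K) (nabla01 D')
     (\<lambda>p. cext (\<lambda>e. J p e - K p e))"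
  unfolding E10_eq_E01
proof (rule holomorphic_bundle_mapI[OF bundle_connections(1,2) J C_section_minus[OF K]
      End_J_minus_K dbar_E01_J dbar_E10_K[unfolded E10_eq_E01]])
  show "J p (J p e) - K p (J p e) = - K p (J p e - K p e)" if "e \<in> fiber E p" for p e
    using that by (simp add: J_rules)
next
  fix U a p v assume U: "open U" and a: "smooth_sec U a" and p: "p \<in> U"
  show "D' p v (\<lambda>q. J q (a q) - K q (a q)) - D' p (cxI v) (\<lambda>q. J q (J q (a q)) - K q (J q (a q))) =
      J p (D p v a - D p (cxI v) (\<lambda>q. J q (a q))) - K p (D p v a - D p (cxI v) (\<lambda>q. J q (a q)))"
  proof -
    note Ja = sec_J[OF U a] and KJa = sec_K[OF U sec_J[OF U a]]
    note fib = twisted.conn_fiber[OF U _ p] antilinear_part_fiber[OF U _ p]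
    \<comment> \<open>\<open>J\<^sup>2 = -1\<close> holds on the fibres only, so these two sections agree only on \<open>U\<close>.\<close>
    have "D' p (cxI v) (\<lambda>q. J q (J q (a q)) - K q (J q (a q))) = D' p (cxI v) (\<lambda>q. - a q - K q (J q (a q)))"
      by (rule twisted.conn_cong[OF U sec_diff[OF U sec_minus[OF U a] KJa] p])
        (simp add: J_rules sec_fiber[OF a])
    then show ?thesis
      by (simp add: twisted.conn_diff[OF U _ _ p] twisted.conn_minus[OF U _ p]
          conn_minus[OF U _ p] twisted_J[OF U a p] twisted_parallel[OF U _ p] D_J[OF U a p]
          D_split[of p _ a] antilinear_part_cxI[OF U _ p] sec_K[OF U] sec_minus[OF U] a Ja KJa fib J_rules algebra_simps)
  qed
qed

text \<open>\<open>(J - K) (J + K) = J K - K J\<close>\<close>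

lemma commutator_01_10:
  "holomorphic_bundle_map A E (E01 E K) (nabla01 D') (E10 E K) (nabla01 D')
     (\<lambda>p. cext (\<lambda>e. J p (K p e) - K p (J p e)))"
proof (rule holomorphic_bundle_map_comp[OF J_plus_K_01 J_minus_K_10])
  show "E01 E K p \<subseteq> fiberC E p" for p by (auto simp: E01_def)
  show "cext (\<lambda>e. J p (K p e) - K p (J p e)) x = cext (\<lambda>e. J p e - K p e) (cext (\<lambda>e. J p e + K p e) x)"
    if "x \<in> fiberC E p" for p x
    using that by (auto simp: fiberC_def cext_def J_rules)
qed

end

end

theorem proposition5p3:
  fixes A :: "('m::{t2_space,second_countable_topology}, 'd::finite) chart set"
    and E :: "('m, 'e::real_vector, 'r::finite) vbundle"
    and D :: "('m, 'd, 'e) covariant_deriv"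
    and J K :: "'m \<Rightarrow> 'e \<Rightarrow> 'e"
    and n :: nat
  assumes "complex_manifold A"
    and "vector_bundle A E" and "CARD('r) = 2 * n"
    and "connection A E D" and "curvature_type_11 A E D"
    and "C_section A E J" and "C_section A E K"
    and "\<And>U s p v. open U \<Longrightarrow> smooth_section A E U s \<Longrightarrow> p \<in> U \<Longrightarrow> nabla_End D J p v s = 0"
    and "\<And>U s p v. open U \<Longrightarrow> smooth_section A E U s \<Longrightarrow> p \<in> U \<Longrightarrow>
           K p (nabla_End D K p v s) = nabla_End D K p (cxI v) s"
  shows "holomorphic_bundle_map A E (E01 E K) (nabla01 (twisted_connection D K)) (E01 E J) (nabla01 D)
           (\<lambda>p. cext (\<lambda>e. J p e + K p e)) \<and>
         holomorphic_bundle_map A E (E01 E K) (nabla01 (twisted_connection D K)) (E10 E J) (nabla01 D)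
           (\<lambda>p. cext (\<lambda>e. J p e - K p e)) \<and>
         holomorphic_bundle_map A E (E10 E J) (nabla01 D) (E10 E K) (nabla01 (twisted_connection D K))
           (\<lambda>p. cext (\<lambda>e. J p e + K p e)) \<and>
         holomorphic_bundle_map A E (E01 E J) (nabla01 D) (E10 E K) (nabla01 (twisted_connection D K))
           (\<lambda>p. cext (\<lambda>e. J p e - K p e)) \<and>
         holomorphic_bundle_map A E (E01 E K) (nabla01 (twisted_connection D K)) (E10 E K) (nabla01 (twisted_connection D K))
           (\<lambda>p. cext (\<lambda>e. J p (K p e) - K p (J p e)))"
proof -
  interpret twisted_bundle A E D K
    by unfold_locales (fact assms)+
  show ?thesis
    using J_plus_K_01[OF assms(6,8)] J_minus_K_01[OF assms(6,8)] J_plus_K_10[OF assms(6,8)]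
      J_minus_K_10[OF assms(6,8)] commutator_01_10[OF assms(6,8)]
    by (intro conjI)
qed

end
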